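(* Let $s, t \geq 2$ be integers. Every $K^{\ast}_{s,t}$-minor-free graph $G$ is isomorphic to a subgraph of $H \boxtimes P \boxtimes K_m$ for some path $P$ and some graph $H$ of simple treewidth at most $s$, where $m := (t-1)\,\mathrm{ltw}(G)$.
   Context: All graphs are finite, simple and undirected. $K^{\ast}_{s,t}$ is the graph whose vertex-set is partitioned into $A \cup B$ with $|A| = s$, $|B| = t$, $A$ a clique, $B$ an independent set, and every vertex of $A$ adjacent to every vertex of $B$. A tree-decomposition is $k$-simple if it has width at most $k$ (all bags of size at most $k+1$) and every set of $k$ vertices is contained in at most two bags; the simple treewidth of a graph is the minimum $k\in\mathbb{N}$ such that it has a $k$-simple tree-decomposition. A layering of $G$ is a partition $(V_1, V_2, \dots)$ of $V(G)$ such that for each edge $vw$ with $v \in V_i$, $w \in V_j$ we have $|i-j| \leq 1$. The layered treewidth $\mathrm{ltw}(G)$ is the minimum integer $k$ such that $G$ has a layering $\mathcal{L}$ and a tree-decomposition $(T,\mathcal{W})$ with $|L \cap W| \leq k$ for every layer $L$ and every bag $W$. The strong product $A \boxtimes B$ has vertex-set $V(A)\times V(B)$, where distinct $(v,x),(w,y)$ are adjacent if ($v=w$ and $xy\in E(B)$), or ($x=y$ and $vw\in E(A)$), or ($vw\in E(A)$ and $xy\in E(B)$). $K_m$ is the complete graph on $m$ vertices. *)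

theory Defs
  imports
    "Graph_Theory.Pair_Digraph"
    "Graph_Theory.Digraph_Component"
    "Graph_Theory.Digraph_Isomorphism"
    "Graph_Theory.Kuratowski"
begin

text \<open>
  A finite simple undirected graph is a term satisfying \<^const>\<open>pair_graph\<close>: finite, loop-free,
  with a symmetric set of arcs, so that an edge \<open>vw\<close> is the pair of arcs \<open>(v, w)\<close>, \<open>(w, v)\<close>.
  The library notion \<^const>\<open>subgraph\<close> is the one for digraphs; a subgraph of an undirected
  graph must in addition be symmetric, hence the extra \<^const>\<open>pair_graph\<close> below.
\<close>

definition contained_in :: "'a pair_pre_digraph \<Rightarrow> 'b pair_pre_digraph \<Rightarrow> bool" where
  "contained_in G X \<longleftrightarrow>
    (\<exists>S. pair_graph S \<and> subgraph (with_proj S) (with_proj X) \<and>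
      digraph_iso (with_proj G) (with_proj S))"


text \<open>The vertex that results from contracting the edge \<open>vw\<close> is again called \<open>v\<close>.\<close>

definition contract_edge :: "'a pair_pre_digraph \<Rightarrow> 'a \<Rightarrow> 'a \<Rightarrow> 'a pair_pre_digraph" where
  "contract_edge G v w =
    (let f = (\<lambda>x. if x = w then v else x)
     in \<lparr> pverts = f ` pverts G,
          parcs = {(f x, f y) | x y. (x, y) \<in> parcs G \<and> f x \<noteq> f y} \<rparr>)"

definition contracts_to :: "'a pair_pre_digraph \<Rightarrow> 'a pair_pre_digraph \<Rightarrow> bool" where
  "contracts_to G G' \<longleftrightarrow> (\<exists>v w. (v, w) \<in> parcs G \<and> G' = contract_edge G v w)"

definition minor_of :: "'b pair_pre_digraph \<Rightarrow> 'a pair_pre_digraph \<Rightarrow> bool" where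
  "minor_of K G \<longleftrightarrow>
    (\<exists>S M. pair_graph S \<and> subgraph (with_proj S) (with_proj G) \<and>
      contracts_to\<^sup>*\<^sup>* S M \<and> digraph_iso (with_proj K) (with_proj M))"

definition Kstar :: "nat \<Rightarrow> nat \<Rightarrow> 'a pair_pre_digraph \<Rightarrow> bool" where
  "Kstar s t K \<longleftrightarrow>
    pair_graph K \<and>
    (\<exists>A B. pverts K = A \<union> B \<and> A \<inter> B = {} \<and> card A = s \<and> card B = t \<and>
      parcs K = {(u, v). u \<in> A \<and> v \<in> A \<and> u \<noteq> v} \<union> A \<times> B \<union> B \<times> A)"

definition Kstar_minor_free :: "nat \<Rightarrow> nat \<Rightarrow> 'a pair_pre_digraph \<Rightarrow> bool" where
  "Kstar_minor_free s t G \<longleftrightarrow>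
    \<not> (\<exists>K :: nat pair_pre_digraph. Kstar s t K \<and> minor_of K G)"


text \<open>
  The library's \<^const>\<open>tree\<close> is not the right notion for symmetric digraphs, as it regards the
  two arcs \<open>(v, w)\<close>, \<open>(w, v)\<close> of an edge as a cycle. The cycles of an undirected graph are the
  directed cycles of length at least three.
\<close>

definition undirected_tree :: "'a pair_pre_digraph \<Rightarrow> bool" where
  "undirected_tree T \<longleftrightarrow>
    pair_graph T \<and> connected (with_proj T) \<and>
    \<not> (\<exists>p. pre_digraph.cycle (with_proj T) p \<and> 3 \<le> length p)"

text \<open>Note that \<^const>\<open>connected\<close> includes non-emptiness.\<close>

definition tree_decomposition ::
    "'a pair_pre_digraph \<Rightarrow> 'n pair_pre_digraph \<Rightarrow> ('n \<Rightarrow> 'a set) \<Rightarrow> bool" where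
  "tree_decomposition G T W \<longleftrightarrow>
    undirected_tree T \<and>
    (\<forall>x \<in> pverts T. W x \<subseteq> pverts G) \<and>
    (\<forall>(v, w) \<in> parcs G. \<exists>x \<in> pverts T. v \<in> W x \<and> w \<in> W x) \<and>
    (\<forall>v \<in> pverts G. connected (with_proj T \<restriction> {x \<in> pverts T. v \<in> W x}))"

text \<open>Bags are counted as nodes of the tree, i.e. with multiplicity.\<close>

definition k_simple ::
    "nat \<Rightarrow> 'a pair_pre_digraph \<Rightarrow> 'n pair_pre_digraph \<Rightarrow> ('n \<Rightarrow> 'a set) \<Rightarrow> bool" where
  "k_simple k G T W \<longleftrightarrow>
    (\<forall>x \<in> pverts T. card (W x) \<le> k + 1) \<and>
    (\<forall>S. S \<subseteq> pverts G \<and> card S = k \<longrightarrow> card {x \<in> pverts T. S \<subseteq> W x} \<le> 2)"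

definition simple_treewidth :: "'a pair_pre_digraph \<Rightarrow> nat" where
  "simple_treewidth G =
    (LEAST k. \<exists>(T :: nat pair_pre_digraph) W. tree_decomposition G T W \<and> k_simple k G T W)"

text \<open>Layers are indexed from \<open>0\<close> and may be empty.\<close>

definition layering :: "'a pair_pre_digraph \<Rightarrow> (nat \<Rightarrow> 'a set) \<Rightarrow> bool" where
  "layering G L \<longleftrightarrow>
    (\<Union>i. L i) = pverts G \<and>
    (\<forall>i j. i \<noteq> j \<longrightarrow> L i \<inter> L j = {}) \<and>
    (\<forall>(v, w) \<in> parcs G. \<forall>i j. v \<in> L i \<and> w \<in> L j \<longrightarrow> \<bar>int i - int j\<bar> \<le> 1)"

definition layered_treewidth :: "'a pair_pre_digraph \<Rightarrow> nat" where
  "layered_treewidth G =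
    (LEAST k. \<exists>L (T :: nat pair_pre_digraph) W.
      layering G L \<and> tree_decomposition G T W \<and>
      (\<forall>i. \<forall>x \<in> pverts T. card (L i \<inter> W x) \<le> k))"


definition path_graph :: "'a pair_pre_digraph \<Rightarrow> bool" where
  "path_graph P \<longleftrightarrow>
    (\<exists>vs. vs \<noteq> [] \<and> distinct vs \<and> pverts P = set vs \<and>
      parcs P = {(u, v). \<exists>i. Suc i < length vs \<and>
        ((u = vs ! i \<and> v = vs ! Suc i) \<or> (u = vs ! Suc i \<and> v = vs ! i))})"

definition strong_product ::
    "'a pair_pre_digraph \<Rightarrow> 'b pair_pre_digraph \<Rightarrow> ('a \<times> 'b) pair_pre_digraph"
    (infixl \<open>\<boxtimes>\<close> 70) where
  "A \<boxtimes> B =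
    \<lparr> pverts = pverts A \<times> pverts B,
      parcs = {((v, x), (w, y)).
        (v, x) \<in> pverts A \<times> pverts B \<and> (w, y) \<in> pverts A \<times> pverts B \<and> (v, x) \<noteq> (w, y) \<and>
        ((v = w \<and> (x, y) \<in> parcs B) \<or>
         (x = y \<and> (v, w) \<in> parcs A) \<or>
         ((v, w) \<in> parcs A \<and> (x, y) \<in> parcs B))} \<rparr>"

end

theory Submission
  imports Defs
begin

text \<open>
  Fix a layering and a tree-decomposition that attain the layered treewidth. It suffices to partition
  \<open>V(G)\<close> into parts, each contained in the union of at most \<open>t - 1\<close> bags, such that the quotient
  \<open>H\<close> has simple treewidth at most \<open>s\<close>: every part then has at most \<open>(t - 1) ltw(G)\<close> vertices in
  each layer.

  The parts are created one by one. A subproblem consists of a set \<open>D\<close> of unassigned vertices whose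
  neighbours lie in at most \<open>s\<close> existing parts, together with a model of a clique outside \<open>D\<close> whose
  branch sets contain these neighbours, one branch set for each part. Call a connected subset of \<open>D\<close>
  linked if it is adjacent to all branch sets. If there are \<open>s\<close> branch sets, then \<open>t\<close> disjoint
  linked sets would give a \<open>K*(s,t)\<close> minor, so by the Erdos-Posa property of subtrees at most
  \<open>t - 1\<close> bags hit all linked sets. The new part is a minimal hitting set \<open>X\<close> inside these bags.
  Each component of \<open>D - X\<close> misses some branch set, say the \<open>j\<close>-th, and by minimality of \<open>X\<close> this
  branch set can be enlarged by all of \<open>X\<close> without meeting the components that miss it; so \<open>X\<close>
  replaces the \<open>j\<close>-th part in the subproblem formed by these components. With fewer than \<open>s\<close> branch
  sets there is a linked set \<open>Q\<close> such that a single bag hits, inside \<open>Q\<close>, all linked sets meeting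
  \<open>Q\<close>, and \<open>Q\<close> can serve as an additional branch set.

  A clique of \<open>s\<close> parts gives rise to only one new part, which makes the resulting
  tree-decomposition of \<open>H\<close> \<open>s\<close>-simple.
\<close>

section \<open>Connected sets\<close>

text \<open>
  Connectedness as the absence of a cut; the empty set counts as connected. Only meaningful for
  symmetric \<open>E\<close>.
\<close>

definition conn_on :: "('a \<times> 'a) set \<Rightarrow> 'a set \<Rightarrow> bool" where
  "conn_on E S \<longleftrightarrow>
    (\<forall>Z. Z \<subseteq> S \<and> Z \<noteq> {} \<and> (\<forall>x \<in> Z. \<forall>y \<in> S. (x, y) \<in> E \<longrightarrow> y \<in> Z) \<longrightarrow> Z = S)"

text \<open>For \<open>u\<close> outside \<open>D\<close> this is just \<open>{u}\<close>; therefore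
  \<open>u \<in> D\<close> accompanies most uses.\<close>

definition comp_of :: "('a \<times> 'a) set \<Rightarrow> 'a set \<Rightarrow> 'a \<Rightarrow> 'a set" where
  "comp_of E D u = (E \<inter> D \<times> D)\<^sup>* `` {u}"

definition touches :: "('a \<times> 'a) set \<Rightarrow> 'a set \<Rightarrow> 'a set \<Rightarrow> bool" where
  "touches E A B \<longleftrightarrow> (\<exists>a \<in> A. \<exists>b \<in> B. (a, b) \<in> E)"

text \<open>Serves as an induction principle: a property that holds at one vertex of a connected set
  and spreads along arcs inside the set holds everywhere in it. \<open>Z\<close> is the set of
  vertices with the property.\<close>

lemma conn_onD:
  assumes "conn_on E S" "Z \<subseteq> S" "z \<in> Z" "\<And>x y. x \<in> Z \<Longrightarrow> y \<in> S \<Longrightarrow> (x, y) \<in> E \<Longrightarrow> y \<in> Z"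
  shows "Z = S"
  using assms(1)[unfolded conn_on_def, rule_format, of Z] assms(2-4) by blast

lemma conn_onI:
  assumes "\<And>Z z. Z \<subseteq> S \<Longrightarrow> z \<in> Z \<Longrightarrow> (\<And>x y. x \<in> Z \<Longrightarrow> y \<in> S \<Longrightarrow> (x, y) \<in> E \<Longrightarrow> y \<in> Z)
    \<Longrightarrow> S \<subseteq> Z"
  shows "conn_on E S"
  unfolding conn_on_def
proof (intro allI impI)
  fix Z assume "Z \<subseteq> S \<and> Z \<noteq> {} \<and> (\<forall>x \<in> Z. \<forall>y \<in> S. (x, y) \<in> E \<longrightarrow> y \<in> Z)"
  moreover then obtain z where "z \<in> Z" by blast
  ultimately show "Z = S" using assms[of Z z] by blast
qed

lemma touches_sym: "sym E \<Longrightarrow> touches E A B \<Longrightarrow> touches E B A"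
  unfolding touches_def by (meson symD)

lemma touches_mono: "touches E A B \<Longrightarrow> A \<subseteq> A' \<Longrightarrow> B \<subseteq> B' \<Longrightarrow> touches E A' B'"
  unfolding touches_def by blast

lemma conn_on_singleton: "conn_on E {x}"
  unfolding conn_on_def by blast

lemma conn_on_Un:
  assumes "sym E" "conn_on E A" "conn_on E B" "A \<inter> B \<noteq> {} \<or> touches E A B"
  shows "conn_on E (A \<union> B)"
proof (rule conn_onI)
  fix Z z assume Z: "Z \<subseteq> A \<union> B" "z \<in> Z"
    and cl: "\<And>x y. x \<in> Z \<Longrightarrow> y \<in> A \<union> B \<Longrightarrow> (x, y) \<in> E \<Longrightarrow> y \<in> Z"
  have A: "A \<subseteq> Z" if "a \<in> Z" "a \<in> A" for a
    using conn_onD[OF assms(2), of "Z \<inter> A" a] that cl by blast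
  have B: "B \<subseteq> Z" if "a \<in> Z" "a \<in> B" for a
    using conn_onD[OF assms(3), of "Z \<inter> B" a] that cl by blast
  from assms(4) have "A \<subseteq> Z \<longleftrightarrow> B \<subseteq> Z"
  proof
    assume "A \<inter> B \<noteq> {}" then show ?thesis using A B by blast
  next
    assume "touches E A B"
    then obtain a b where "a \<in> A" "b \<in> B" "(a, b) \<in> E" "(b, a) \<in> E"
      using assms(1) unfolding touches_def by (meson symD)
    then show ?thesis using A B cl by blast
  qed
  then show "A \<union> B \<subseteq> Z" using A B Z by blast
qed

lemma comp_of_self [simp]: "u \<in> comp_of E D u"
  by (simp add: comp_of_def)

lemma comp_of_subset: "u \<in> D \<Longrightarrow> comp_of E D u \<subseteq> D"
proof
  fix x assume "u \<in> D" "x \<in> comp_of E D u"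
  then have "(u, x) \<in> (E \<inter> D \<times> D)\<^sup>*" by (simp add: comp_of_def)
  then show "x \<in> D" using \<open>u \<in> D\<close> by cases auto
qed

lemma comp_of_closed:
  assumes "x \<in> comp_of E D u" "u \<in> D" "y \<in> D" "(x, y) \<in> E"
  shows "y \<in> comp_of E D u"
proof -
  have "x \<in> D" using assms(1) comp_of_subset[OF assms(2)] by (rule subsetD[rotated])
  then have xy: "(x, y) \<in> E \<inter> D \<times> D" using assms(3,4) by simp
  have "(u, x) \<in> (E \<inter> D \<times> D)\<^sup>*" using assms(1) by (simp add: comp_of_def)
  from rtrancl_into_rtrancl[OF this xy] show ?thesis by (simp add: comp_of_def)
qed

lemma comp_of_sym:
  assumes "sym E" "x \<in> comp_of E D u"
  shows "u \<in> comp_of E D x"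
proof -
  have "sym (E \<inter> D \<times> D)" using assms(1) unfolding sym_def by blast
  then show ?thesis using assms(2) unfolding comp_of_def by (simp add: sym_rtrancl symD)
qed

lemma comp_of_eq:
  assumes "sym E" "x \<in> comp_of E D u"
  shows "comp_of E D x = comp_of E D u"
proof -
  let ?R = "(E \<inter> D \<times> D)\<^sup>*"
  have "(u, x) \<in> ?R" "(x, u) \<in> ?R"
    using comp_of_sym[OF assms] assms(2) unfolding comp_of_def by simp_all
  then have "(x, y) \<in> ?R \<longleftrightarrow> (u, y) \<in> ?R" for y using rtrancl_trans by metis
  then show ?thesis unfolding comp_of_def by blast
qed

lemma conn_on_comp_of:
  assumes "sym E" "u \<in> D"
  shows "conn_on E (comp_of E D u)"
proof (rule conn_onI)
  fix Z z assume Z: "Z \<subseteq> comp_of E D u" "z \<in> Z"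
    and cl: "\<And>x y. x \<in> Z \<Longrightarrow> y \<in> comp_of E D u \<Longrightarrow> (x, y) \<in> E \<Longrightarrow> y \<in> Z"
  have eq: "comp_of E D z = comp_of E D u" using comp_of_eq[OF assms(1)] Z by blast
  show "comp_of E D u \<subseteq> Z"
  proof
    fix y assume "y \<in> comp_of E D u"
    then have "(z, y) \<in> (E \<inter> D \<times> D)\<^sup>*" using eq unfolding comp_of_def by blast
    then show "y \<in> Z"
    proof induction
      case base then show ?case using Z by simp
    next
      case (step y w)
      have "w \<in> comp_of E D u"
        using step comp_of_closed[of y E D u w] Z(1) assms(2) by blast
      then show ?case using step cl by blast
    qed
  qed
qed

lemma conn_on_subset_comp_of:
  assumes "conn_on E F" "F \<subseteq> D" "x \<in> F" "x \<in> comp_of E D u" "u \<in> D"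
  shows "F \<subseteq> comp_of E D u"
proof -
  have "F \<inter> comp_of E D u = F"
  proof (rule conn_onD[OF assms(1)])
    show "x \<in> F \<inter> comp_of E D u" using assms by simp
    show "b \<in> F \<inter> comp_of E D u" if "a \<in> F \<inter> comp_of E D u" "b \<in> F" "(a, b) \<in> E" for a b
      using comp_of_closed[of a E D u b] that assms(2,5) by auto
  qed simp
  then show ?thesis by blast
qed

section \<open>Cut-connectedness and digraph notions\<close>

text \<open>As the arcs are symmetric, symmetrising the induced subgraph adds no arc, and
  reachability in it is membership in \<open>comp_of\<close>. Nonemptiness is part of
  \<open>connected\<close>.\<close>

lemma connected_induce_iff:
  fixes T :: "'n pair_pre_digraph"
  assumes "sym (parcs T)"
  shows "connected (with_proj T \<restriction> M) \<longleftrightarrow> M \<noteq> {} \<and> conn_on (parcs T) M"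
proof -
  define E where "E = parcs T"
  have sE: "sym E" using assms by (simp add: E_def)
  let ?R = "E \<inter> M \<times> M"
  have ms: "mk_symmetric (with_proj T \<restriction> M) = \<lparr>pverts = M, parcs = ?R\<rparr>"
    using sE unfolding mk_symmetric_def induce_subgraph_def E_def sym_def by auto
  have wf: "wf_digraph (with_proj \<lparr>pverts = M, parcs = ?R\<rparr>)"
    by unfold_locales auto
  have reach: "u \<rightarrow>\<^sup>*\<^bsub>with_proj \<lparr>pverts = M, parcs = ?R\<rparr>\<^esub> v \<longleftrightarrow> u \<in> M \<and> v \<in> M \<and> v \<in> comp_of E M u"
    for u v
    using wf_digraph.reachable_conv[OF wf, of u v] unfolding comp_of_def by auto
  have "(\<forall>u \<in> M. \<forall>v \<in> M. v \<in> comp_of E M u) \<longleftrightarrow> conn_on E M"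
  proof
    assume all: "\<forall>u \<in> M. \<forall>v \<in> M. v \<in> comp_of E M u"
    show "conn_on E M"
    proof (cases "M = {}")
      case False
      then obtain u where u: "u \<in> M" by blast
      then have "comp_of E M u = M" using all comp_of_subset[OF u, of E] by blast
      then show ?thesis using conn_on_comp_of[OF sE u] by simp
    qed (simp add: conn_on_def)
  next
    assume "conn_on E M"
    then show "\<forall>u \<in> M. \<forall>v \<in> M. v \<in> comp_of E M u"
      using conn_on_subset_comp_of[of E M M] by (metis comp_of_self order_refl subsetD)
  qed
  then show ?thesis
    unfolding connected_def strongly_connected_def ms using reach by (auto simp: E_def)
qed

lemma connected_iff:
  fixes T :: "'n pair_pre_digraph"
  assumes "pair_graph T"
  shows "connected (with_proj T) \<longleftrightarrow> pverts T \<noteq> {} \<and> conn_on (parcs T) (pverts T)"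
proof -
  interpret pair_graph T by fact
  have "sym (parcs T)" using arcs_symmetric by (auto intro: symI)
  moreover have "with_proj T \<restriction> pverts T = with_proj T"
    unfolding induce_subgraph_def with_proj_def using in_arcsD1 in_arcsD2 by auto
  ultimately show ?thesis using connected_induce_iff[of T "pverts T"] by simp
qed

lemma pair_graphI:
  assumes "finite (pverts G)" "parcs G \<subseteq> pverts G \<times> pverts G" "sym (parcs G)"
    "\<And>x y. (x, y) \<in> parcs G \<Longrightarrow> x \<noteq> y"
  shows "pair_graph G"
proof -
  have "finite (parcs G)" using assms(1,2) by (meson finite_SigmaI finite_subset)
  then show ?thesis using assms
    by unfold_locales (auto simp: symmetric_def)
qed

lemma pair_graph_sym: "pair_graph G \<Longrightarrow> sym (parcs G)"
proof -
  assume "pair_graph G"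
  then interpret pair_graph G .
  show ?thesis using arcs_symmetric by (auto intro: symI)
qed

lemma pair_graph_arcsD:
  assumes "pair_graph G" "(x, y) \<in> parcs G"
  shows "x \<in> pverts G" "y \<in> pverts G" "x \<noteq> y" "(y, x) \<in> parcs G"
proof -
  interpret pair_graph G by fact
  show "x \<in> pverts G" "y \<in> pverts G" "x \<noteq> y" "(y, x) \<in> parcs G"
    using assms(2) in_arcsD1 in_arcsD2 no_loops' arcs_symmetric by auto
qed

lemma pair_graph_finite: "pair_graph S \<Longrightarrow> finite (pverts S)"
  by (simp add: pair_graph_def pair_digraph_def pair_fin_digraph_def pair_fin_digraph_axioms_def)

lemma pair_graph_wf: "pair_graph G \<Longrightarrow> wf_digraph (with_proj G)"
  by (simp add: wf_digraph_wp_iff pair_graph_def pair_digraph_def pair_fin_digraph_def)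

lemma digraph_iso_with_projI:
  assumes "pair_graph A" "inj_on g (pverts A)" "pverts B = g ` pverts A"
    "parcs B = map_prod g g ` parcs A"
  shows "digraph_iso (with_proj A) (with_proj B)"
proof -
  let ?h = "\<lparr>iso_verts = g, iso_arcs = map_prod g g, iso_head = snd, iso_tail = fst\<rparr>"
  have "inj_on (map_prod g g) (parcs A)"
    using assms(2) pair_graph_arcsD[OF assms(1)] by (auto simp: inj_on_def)
  then have "pre_digraph.digraph_isomorphism (with_proj A) ?h"
    unfolding pre_digraph.digraph_isomorphism_def
    using assms(2) pair_graph_wf[OF assms(1)] by auto
  moreover have "with_proj B = app_iso ?h (with_proj A)"
    using assms(3,4) by (simp add: app_iso_def with_proj_def)
  ultimately show ?thesis unfolding digraph_iso_def by blast
qed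

lemma subgraph_with_projI:
  assumes "pair_graph A" "pair_graph B" "pverts A \<subseteq> pverts B" "parcs A \<subseteq> parcs B"
  shows "subgraph (with_proj A) (with_proj B)"
  unfolding subgraph_def compatible_def
  using assms(3,4) pair_graph_wf[OF assms(1)] pair_graph_wf[OF assms(2)] by simp

section \<open>Minors from branch sets\<close>

definition quotient_graph :: "('a \<Rightarrow> 'b) \<Rightarrow> 'a pair_pre_digraph \<Rightarrow> 'b pair_pre_digraph" where
  "quotient_graph f S =
    \<lparr>pverts = f ` pverts S, parcs = {(f x, f y) | x y. (x, y) \<in> parcs S \<and> f x \<noteq> f y}\<rparr>"

lemma quotient_graph_arcI:
  "(x, y) \<in> parcs S \<Longrightarrow> f x \<noteq> f y \<Longrightarrow> (f x, f y) \<in> parcs (quotient_graph f S)"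
  unfolding quotient_graph_def by auto

lemma contract_edge_eq_quotient:
  "contract_edge G v w = quotient_graph (\<lambda>x. if x = w then v else x) G"
  unfolding contract_edge_def quotient_graph_def by simp

lemma pair_graph_quotient: "pair_graph S \<Longrightarrow> pair_graph (quotient_graph f S)"
proof (rule pair_graphI)
  assume S: "pair_graph S"
  show "finite (pverts (quotient_graph f S))"
    using pair_graph_finite[OF S] by (simp add: quotient_graph_def)
  show "parcs (quotient_graph f S) \<subseteq> pverts (quotient_graph f S) \<times> pverts (quotient_graph f S)"
    using pair_graph_arcsD[OF S] by (auto simp: quotient_graph_def)
  show "sym (parcs (quotient_graph f S))"
    using pair_graph_arcsD[OF S] unfolding quotient_graph_def sym_def by fastforce
  show "\<And>x y. (x, y) \<in> parcs (quotient_graph f S) \<Longrightarrow> x \<noteq> y"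
    by (auto simp: quotient_graph_def)
qed

text \<open>Induction on the number of vertices. If \<open>f\<close> is injective, the quotient is a
  renaming. Otherwise some fibre has two vertices, and being connected it contains an arc
  \<open>(v, w)\<close>. Contracting this arc keeps all fibres connected and does not change the
  quotient.\<close>

lemma contracts_to_quotient:
  fixes f :: "'a \<Rightarrow> 'b"
  assumes "pair_graph S" "\<And>l. conn_on (parcs S) {x \<in> pverts S. f x = l}"
  shows "\<exists>M. contracts_to\<^sup>*\<^sup>* S M \<and> digraph_iso (with_proj (quotient_graph f S)) (with_proj M)"
  using assms
proof (induction "card (pverts S)" arbitrary: S rule: less_induct)
  case less
  show ?case
  proof (cases "inj_on f (pverts S)")
    case True
    let ?g = "the_inv_into (pverts S) f"
    have g: "?g (f x) = x" if "x \<in> pverts S" for x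
      using True that by (simp add: the_inv_into_f_f)
    have ne: "f x \<noteq> f y" if "(x, y) \<in> parcs S" for x y
      using pair_graph_arcsD[OF less.prems(1) that] True by (meson inj_onD)
    have "parcs S = map_prod ?g ?g ` parcs (quotient_graph f S)"
    proof (intro set_eqI iffI)
      fix e assume e: "e \<in> parcs S"
      obtain x y where xy: "e = (x, y)" by (cases e)
      have "e = map_prod ?g ?g (f x, f y)"
        using xy e g pair_graph_arcsD[OF less.prems(1)] by simp
      moreover have "(f x, f y) \<in> parcs (quotient_graph f S)"
        using xy e ne unfolding quotient_graph_def by auto
      ultimately show "e \<in> map_prod ?g ?g ` parcs (quotient_graph f S)" by blast
    next
      fix e assume "e \<in> map_prod ?g ?g ` parcs (quotient_graph f S)"
      then show "e \<in> parcs S"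
        using pair_graph_arcsD[OF less.prems(1)] g by (auto simp: quotient_graph_def)
    qed
    moreover have "inj_on ?g (pverts (quotient_graph f S))"
      using True by (simp add: quotient_graph_def inj_on_the_inv_into)
    moreover have "pverts S = ?g ` pverts (quotient_graph f S)"
      using g by (simp add: quotient_graph_def image_image)
    ultimately have "digraph_iso (with_proj (quotient_graph f S)) (with_proj S)"
      by (intro digraph_iso_with_projI pair_graph_quotient less.prems)
    then show ?thesis by blast
  next
    case False
    then obtain v b where vb: "v \<in> pverts S" "b \<in> pverts S" "f v = f b" "v \<noteq> b"
      unfolding inj_on_def by blast
    let ?B = "{x \<in> pverts S. f x = f v}"
    have "\<exists>w. (v, w) \<in> parcs S \<and> w \<in> ?B"
    proof (rule ccontr)
      assume none: "\<not> ?thesis"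
      have "{v} = ?B"
      proof (rule conn_onD[OF less.prems(2)])
        show "{v} \<subseteq> ?B" using vb by simp
        show "y \<in> {v}" if "x \<in> {v}" "y \<in> ?B" "(x, y) \<in> parcs S" for x y
          using none that by blast
      qed simp
      then show False using vb by auto
    qed
    then obtain w where w: "(v, w) \<in> parcs S" "w \<in> ?B" by blast
    have vw: "v \<noteq> w" using pair_graph_arcsD[OF less.prems(1) w(1)] by blast
    define h where "h = (\<lambda>x. if x = w then v else x)"
    define S' where "S' = contract_edge S v w"
    have S'q: "S' = quotient_graph h S" by (simp add: S'_def h_def contract_edge_eq_quotient)
    have pg: "pair_graph S'" unfolding S'q by (rule pair_graph_quotient[OF less.prems(1)])
    have pv: "pverts S' = pverts S - {w}" unfolding S'q quotient_graph_def h_def using vb vw by auto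
    have fh: "f (h x) = f x" for x using w by (simp add: h_def)
    have c: "contracts_to S S'" unfolding contracts_to_def S'_def using w by blast
    have "card (pverts S') < card (pverts S)"
      unfolding pv using w pair_graph_finite[OF less.prems(1)] by (intro psubset_card_mono) auto
    moreover have "conn_on (parcs S') {x \<in> pverts S'. f x = l}" for l
    proof (rule conn_onI)
      fix Z z assume Z: "Z \<subseteq> {x \<in> pverts S'. f x = l}" "z \<in> Z"
        and cl: "\<And>x y. x \<in> Z \<Longrightarrow> y \<in> {x \<in> pverts S'. f x = l} \<Longrightarrow> (x, y) \<in> parcs S' \<Longrightarrow> y \<in> Z"
      \<comment> \<open>A closed part \<open>Z\<close> of a fibre after the contraction is pulled
        back along \<open>h\<close>; the preimage is closed in the old fibre, hence equal to
        it.\<close>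
      let ?Y = "{x \<in> pverts S. f x = l \<and> h x \<in> Z}"
      have "?Y = {x \<in> pverts S. f x = l}"
      proof (rule conn_onD[OF less.prems(2)])
        show "z \<in> ?Y" using Z unfolding pv h_def by auto
        fix x y assume x: "x \<in> ?Y" and y: "y \<in> {x \<in> pverts S. f x = l}" and xy: "(x, y) \<in> parcs S"
        show "y \<in> ?Y"
        proof (cases "h x = h y")
          case True then show ?thesis using x y by simp
        next
          case False
          then have "(h x, h y) \<in> parcs S'" using xy unfolding S'q by (intro quotient_graph_arcI)
          moreover have "h y \<in> {x \<in> pverts S'. f x = l}"
            using y w(2) vb(1) vw unfolding pv h_def by auto
          moreover have "h x \<in> Z" using x by blast
          ultimately have "h y \<in> Z" using cl by metis
          then show ?thesis using y by blast
        qed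
      qed blast
      then have "h x \<in> Z" if "x \<in> pverts S'" "f x = l" for x using that unfolding pv by blast
      then show "{x \<in> pverts S'. f x = l} \<subseteq> Z" unfolding pv h_def by fastforce
    qed
    ultimately obtain M where M: "contracts_to\<^sup>*\<^sup>* S' M"
      "digraph_iso (with_proj (quotient_graph f S')) (with_proj M)"
      using less.hyps[OF _ pg] by blast
    have "parcs (quotient_graph f S') = parcs (quotient_graph f S)"
    proof (intro set_eqI iffI)
      fix e assume "e \<in> parcs (quotient_graph f S)"
      then obtain x y where xy: "e = (f x, f y)" "(x, y) \<in> parcs S" "f x \<noteq> f y"
        by (auto simp: quotient_graph_def)
      then have "h x \<noteq> h y" using fh[of x] fh[of y] by metis
      then have "(h x, h y) \<in> parcs S'" using xy(2) unfolding S'q by (intro quotient_graph_arcI)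
      moreover have "e = (f (h x), f (h y))" using xy fh[of x] fh[of y] by simp
      ultimately show "e \<in> parcs (quotient_graph f S')"
        using xy(3) fh quotient_graph_arcI[of "h x" "h y" S' f] by metis
    next
      fix e assume "e \<in> parcs (quotient_graph f S')"
      then obtain x y where xy: "e = (f x, f y)" "(x, y) \<in> parcs S'" "f x \<noteq> f y"
        by (auto simp: quotient_graph_def)
      then obtain a b where "(a, b) \<in> parcs S" "x = h a" "y = h b"
        unfolding S'q quotient_graph_def by auto
      then show "e \<in> parcs (quotient_graph f S)"
        using xy fh quotient_graph_arcI[of a b S f] by metis
    qed
    moreover have "pverts (quotient_graph f S') = pverts (quotient_graph f S)"
    proof -
      have "f w \<in> f ` (pverts S - {w})" using vb(1) vw w(2) by (metis (mono_tags, lifting)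
        Diff_iff image_eqI mem_Collect_eq singletonD)
      moreover have "pverts S = insert w (pverts S - {w})" using w(2) by blast
      ultimately have "f ` pverts S = f ` (pverts S - {w})" by (metis image_insert insert_absorb)
      then show ?thesis by (simp add: quotient_graph_def pv)
    qed
    ultimately have "quotient_graph f S' = quotient_graph f S" by simp
    then show ?thesis using M converse_rtranclp_into_rtranclp[of contracts_to, OF c M(1)] by auto
  qed
qed

lemma conn_on_arcs_mono:
  assumes "conn_on E S" "\<And>x y. x \<in> S \<Longrightarrow> y \<in> S \<Longrightarrow> (x, y) \<in> E \<Longrightarrow> (x, y) \<in> E'"
  shows "conn_on E' S"
proof (rule conn_onI)
  fix Z z assume Z: "Z \<subseteq> S" "z \<in> Z"
    and cl: "\<And>x y. x \<in> Z \<Longrightarrow> y \<in> S \<Longrightarrow> (x, y) \<in> E' \<Longrightarrow> y \<in> Z"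
  have "Z = S"
    by (rule conn_onD[OF assms(1) Z]) (use cl assms(2) Z(1) in blast)
  then show "S \<subseteq> Z" by simp
qed

text \<open>\<open>minor_of\<close> deletes first and contracts afterwards. So the subgraph
  \<open>S\<close> keeps, besides the arcs inside branch sets, only those between branch sets that
  \<open>R\<close> relates; contracting the branch sets then leaves exactly
  \<open>R\<close>.\<close>

lemma minor_of_model:
  fixes b :: "'i \<Rightarrow> 'a set"
  assumes G: "pair_graph G"
    and b: "\<And>i. i \<in> I \<Longrightarrow> b i \<subseteq> pverts G \<and> b i \<noteq> {} \<and> conn_on (parcs G) (b i)"
    and disj: "\<And>i j. i \<in> I \<Longrightarrow> j \<in> I \<Longrightarrow> i \<noteq> j \<Longrightarrow> b i \<inter> b j = {}"
    and R: "R \<subseteq> I \<times> I" "sym R" "\<And>i. (i, i) \<notin> R"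
    and tch: "\<And>i j. (i, j) \<in> R \<Longrightarrow> touches (parcs G) (b i) (b j)"
  shows "minor_of \<lparr>pverts = I, parcs = R\<rparr> G"
proof -
  define U where "U = (\<Union>i \<in> I. b i)"
  define g where "g x = (THE i. i \<in> I \<and> x \<in> b i)" for x
  have g: "g x = i" if "i \<in> I" "x \<in> b i" for x i
    unfolding g_def by (rule the_equality) (use that disj in blast)+
  define S where "S = \<lparr>pverts = U,
    parcs = {(x, y) \<in> parcs G. x \<in> U \<and> y \<in> U \<and> (g x = g y \<or> (g x, g y) \<in> R)}\<rparr>"
  have UG: "U \<subseteq> pverts G" unfolding U_def using b by blast
  have S: "pair_graph S"
  proof (rule pair_graphI)
    show "finite (pverts S)"
      using finite_subset[OF UG pair_graph_finite[OF G]] by (simp add: S_def)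
    show "parcs S \<subseteq> pverts S \<times> pverts S" by (auto simp: S_def)
    show "sym (parcs S)"
      using pair_graph_sym[OF G] R(2) unfolding S_def sym_def by auto
    show "x \<noteq> y" if "(x, y) \<in> parcs S" for x y
      using that pair_graph_arcsD(3)[OF G, of x y] by (simp add: S_def)
  qed
  have sub: "subgraph (with_proj S) (with_proj G)"
    by (rule subgraph_with_projI[OF S G]) (use UG in \<open>auto simp: S_def\<close>)
  have fib: "{x \<in> pverts S. g x = l} = (if l \<in> I then b l else {})" for l
    using g unfolding S_def U_def by auto
  have "conn_on (parcs S) {x \<in> pverts S. g x = l}" for l
  proof (cases "l \<in> I")
    case True
    have "conn_on (parcs S) (b l)"
    proof (rule conn_on_arcs_mono)
      show "conn_on (parcs G) (b l)" using b True by blast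
      show "(x, y) \<in> parcs S" if "x \<in> b l" "y \<in> b l" "(x, y) \<in> parcs G" for x y
        using that True g unfolding S_def U_def by auto
    qed
    then show ?thesis using True fib by simp
  qed (simp add: fib conn_on_def)
  from contracts_to_quotient[OF S this]
  obtain M where M: "contracts_to\<^sup>*\<^sup>* S M" "digraph_iso (with_proj (quotient_graph g S)) (with_proj M)"
    by blast
  have gU: "g ` U = I"
  proof
    show "g ` U \<subseteq> I" using g unfolding U_def by auto
    show "I \<subseteq> g ` U"
    proof
      fix i assume i: "i \<in> I"
      then obtain x where "x \<in> b i" using b by blast
      then show "i \<in> g ` U" using g[OF i] i unfolding U_def by blast
    qed
  qed
  have "parcs (quotient_graph g S) = R"
  proof (intro set_eqI iffI)
    fix e assume "e \<in> parcs (quotient_graph g S)"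
    then show "e \<in> R" by (auto simp: quotient_graph_def S_def)
  next
    fix e assume e: "e \<in> R"
    obtain i j where ij: "e = (i, j)" by (cases e)
    have I: "i \<in> I" "j \<in> I" "i \<noteq> j" using e R ij by auto
    obtain x y where xy: "x \<in> b i" "y \<in> b j" "(x, y) \<in> parcs G"
      using tch[of i j] e ij unfolding touches_def by blast
    have gg: "g x = i" "g y = j" using g I xy by blast+
    have "(x, y) \<in> parcs S" using xy I gg e ij unfolding S_def U_def by auto
    then have "(g x, g y) \<in> parcs (quotient_graph g S)"
      by (rule quotient_graph_arcI) (simp add: gg I)
    then show "e \<in> parcs (quotient_graph g S)" by (simp add: gg ij)
  qed
  moreover have "pverts (quotient_graph g S) = I" using gU by (simp add: quotient_graph_def S_def)
  ultimately have "quotient_graph g S = \<lparr>pverts = I, parcs = R\<rparr>" by simp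
  then show ?thesis unfolding minor_of_def using S sub M by auto
qed

lemma Kstar_minor_model:
  fixes V :: "nat \<Rightarrow> 'a set" and f :: "nat \<Rightarrow> 'a set"
  assumes G: "pair_graph G" and K: "finite K" "card K = s"
    and V: "\<And>i. i \<in> K \<Longrightarrow> V i \<subseteq> pverts G \<and> V i \<noteq> {} \<and> conn_on (parcs G) (V i)"
    and Vd: "\<And>i j. i \<in> K \<Longrightarrow> j \<in> K \<Longrightarrow> i \<noteq> j \<Longrightarrow> V i \<inter> V j = {}"
    and Vt: "\<And>i j. i \<in> K \<Longrightarrow> j \<in> K \<Longrightarrow> i \<noteq> j \<Longrightarrow> touches (parcs G) (V i) (V j)"
    and f: "\<And>k. k < t \<Longrightarrow> f k \<subseteq> pverts G \<and> f k \<noteq> {} \<and> conn_on (parcs G) (f k)"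
    and fd: "\<And>k l. k < t \<Longrightarrow> l < t \<Longrightarrow> k \<noteq> l \<Longrightarrow> f k \<inter> f l = {}"
    and fV: "\<And>k i. k < t \<Longrightarrow> i \<in> K \<Longrightarrow> f k \<inter> V i = {} \<and> touches (parcs G) (f k) (V i)"
  shows "\<not> Kstar_minor_free s t G"
proof -
  \<comment> \<open>\<open>Kstar_minor_free\<close> speaks of graphs on the naturals: the clique
    keeps its indices \<open>K\<close>, and the independent side \<open>B\<close> is an interval
    starting at \<open>c\<close>, beyond all of \<open>K\<close>.\<close>
  define c where "c = Suc (Max (insert 0 K))"
  have c: "i < c" if "i \<in> K" for i
    using that K(1) unfolding c_def by (simp add: less_Suc_eq_le)
  define B where "B = {c..<c + t}"
  define b where "b i = (if i \<in> K then V i else f (i - c))" for i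
  have dB: "K \<inter> B = {}" using c unfolding B_def by fastforce
  let ?R = "{(u, v). u \<in> K \<and> v \<in> K \<and> u \<noteq> v} \<union> K \<times> B \<union> B \<times> K"
  let ?H = "\<lparr>pverts = K \<union> B, parcs = ?R\<rparr>"
  have bB: "b i = f (i - c) \<and> i - c < t" if "i \<in> B" for i
    using that dB unfolding b_def B_def by auto
  have bK: "b i = V i" if "i \<in> K" for i using that by (simp add: b_def)
  have sE: "sym (parcs G)" by (rule pair_graph_sym[OF G])
  have symR: "sym ?R" unfolding sym_def by blast
  have "minor_of ?H G"
  proof (rule minor_of_model[OF G])
    show "b i \<subseteq> pverts G \<and> b i \<noteq> {} \<and> conn_on (parcs G) (b i)" if "i \<in> K \<union> B" for i
    proof (cases "i \<in> K")
      case False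
      then show ?thesis using that bB[of i] f[of "i - c"] by simp
    qed (simp add: bK V)
    show "b i \<inter> b j = {}" if ij: "i \<in> K \<union> B" "j \<in> K \<union> B" "i \<noteq> j" for i j
    proof -
      consider "i \<in> K" "j \<in> K" | "i \<in> K" "j \<in> B" | "i \<in> B" "j \<in> K" | "i \<in> B" "j \<in> B"
        using ij by blast
      then show ?thesis
      proof cases
        case 1 then show ?thesis using Vd ij(3) bK by simp
      next
        case 2 then show ?thesis using fV[of "j - c" i] bK[of i] bB[of j] by auto
      next
        case 3 then show ?thesis using fV[of "i - c" j] bK[of j] bB[of i] by auto
      next
        case 4
        then have "i - c \<noteq> j - c" using ij(3) unfolding B_def by auto
        then show ?thesis using fd[of "i - c" "j - c"] bB[of i] bB[of j] 4 by simp
      qed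
    qed
    show "touches (parcs G) (b i) (b j)" if ij: "(i, j) \<in> ?R" for i j
    proof -
      consider "i \<in> K" "j \<in> K" "i \<noteq> j" | "i \<in> K" "j \<in> B" | "i \<in> B" "j \<in> K" using ij by blast
      then show ?thesis
      proof cases
        case 1 then show ?thesis using Vt bK by simp
      next
        case 2 then show ?thesis using touches_sym[OF sE] fV[of "j - c" i] bK[of i] bB[of j] by simp
      next
        case 3 then show ?thesis using fV[of "i - c" j] bK[of j] bB[of i] by simp
      qed
    qed
  qed (use dB symR in auto)
  moreover have "Kstar s t ?H"
  proof -
    have "pair_graph ?H"
    proof (rule pair_graphI)
      show "x \<noteq> y" if "(x, y) \<in> parcs ?H" for x y using that dB by auto
    qed (use K symR in \<open>auto simp: B_def\<close>)
    moreover have "card B = t" by (simp add: B_def)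
    ultimately show ?thesis unfolding Kstar_def
      by (intro conjI exI[of _ K] exI[of _ B]) (simp_all add: K dB)
  qed
  ultimately show ?thesis unfolding Kstar_minor_free_def by blast
qed

section \<open>Packing and hitting in tree-decompositions\<close>

text \<open>A path in \<open>S\<close> from \<open>a\<close> to \<open>b\<close> closes up through
  \<open>z\<close>. It has at least one arc because \<open>a \<noteq> b\<close>, so the cycle has
  length at least three.\<close>

lemma cycle_through_outside_vertex:
  assumes T: "pair_graph T" and S: "S \<subseteq> pverts T" "conn_on (parcs T) S"
    and ab: "a \<in> S" "b \<in> S" "a \<noteq> b" and z: "z \<notin> S" "(z, a) \<in> parcs T" "(z, b) \<in> parcs T"
  shows "\<exists>p. pre_digraph.cycle (with_proj T) p \<and> 3 \<le> length p"
proof -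
  let ?H = "\<lparr>pverts = S, parcs = parcs T \<inter> S \<times> S\<rparr>"
  interpret T: pair_graph T by fact
  interpret H: pair_wf_digraph ?H by unfold_locales auto
  have "b \<in> comp_of (parcs T) S a"
    using conn_on_subset_comp_of[OF S(2) order_refl ab(1) comp_of_self ab(1)] ab(2) by blast
  then have "a \<rightarrow>\<^sup>*\<^bsub>with_proj ?H\<^esub> b"
    using ab H.reachable_conv[of a b] by (simp add: comp_of_def)
  then obtain q where q: "H.apath a q b" using H.reachable_apath by blast
  then have q': "set q \<subseteq> parcs T" "pcas a q b" "distinct (pawalk_verts a q)"
    and qS: "set (pawalk_verts a q) \<subseteq> S"
    unfolding H.apath_def H.awalk_conv by auto
  have "q \<noteq> []" using q ab(3) by (auto simp: H.apath_Nil_iff)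
  let ?p = "(z, a) # q @ [(b, z)]"
  have zb: "(b, z) \<in> parcs T" "z \<in> pverts T" using pair_graph_arcsD[OF T z(3)] by auto
  have cas: "pcas u (q @ [(b, z)]) z" if "pcas u q b" for u
    using that by (induct q arbitrary: u) auto
  have verts: "pawalk_verts u (q @ [(b, z)]) = pawalk_verts u q @ [z]" if "pcas u q b" for u
    using that by (induct q arbitrary: u) auto
  have "T.awalk z ?p z"
    unfolding T.awalk_def using q'(1) z(2) zb cas[OF q'(2)] by simp
  moreover have "distinct (tl (pawalk_verts z ?p))"
    using verts[OF q'(2)] q'(3) qS z(1) by auto
  ultimately have "T.cycle ?p" unfolding T.cycle_def by blast
  moreover have "3 \<le> length ?p" using \<open>q \<noteq> []\<close> by (cases q) auto
  ultimately show ?thesis by blast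
qed

text \<open>A tree given by parent pointers. The rank only has to decrease towards the root; this
  makes climbing terminate and lets the topmost node of a connected set be chosen as one of minimal
  rank.\<close>

definition rooted_order ::
    "('n \<times> 'n) set \<Rightarrow> 'n set \<Rightarrow> 'n \<Rightarrow> ('n \<Rightarrow> 'n) \<Rightarrow> ('n \<Rightarrow> nat) \<Rightarrow> bool" where
  "rooted_order E S r par rk \<longleftrightarrow> r \<in> S \<and>
    (\<forall>x \<in> S - {r}. par x \<in> S \<and> rk (par x) < rk x) \<and>
    (\<forall>x \<in> S. \<forall>y \<in> S. (x, y) \<in> E \<longrightarrow> (x \<noteq> r \<and> y = par x) \<or> (y \<noteq> r \<and> x = par y))"

text \<open>Take a maximal connected set with a rooted order. If it were not everything, an arc
  would lead from it to a new vertex \<open>z\<close>. The neighbour of \<open>z\<close> in the set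
  is unique, as two of them would close a cycle, so \<open>z\<close> could be added as a
  leaf.\<close>

lemma undirected_tree_rooted_order:
  assumes "undirected_tree T"
  shows "\<exists>r par rk. rooted_order (parcs T) (pverts T) r par rk"
proof -
  let ?E = "parcs T" and ?V = "pverts T"
  have T: "pair_graph T" and conn: "?V \<noteq> {}" "conn_on ?E ?V"
    and acyc: "\<not> (\<exists>p. pre_digraph.cycle (with_proj T) p \<and> 3 \<le> length p)"
    using assms connected_iff[of T] unfolding undirected_tree_def by auto
  have sE: "sym ?E" by (rule pair_graph_sym[OF T])
  define P where "P S \<longleftrightarrow> S \<subseteq> ?V \<and> conn_on ?E S \<and> (\<exists>r par rk. rooted_order ?E S r par rk)" for S
  obtain r where r: "r \<in> ?V" using conn by blast
  have "rooted_order ?E {r} r id (\<lambda>_. 0)"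
    unfolding rooted_order_def using pair_graph_arcsD(3)[OF T, of r r] by auto
  then have P0: "P {r}" using r conn_on_singleton[of ?E r] unfolding P_def by blast
  have fin: "finite {S. P S}"
    using pair_graph_finite[OF T] by (rule rev_finite_subset[OF finite_Pow_iff[THEN iffD2]]) (auto simp: P_def)
  have "{S. P S} \<noteq> {}" using P0 by blast
  from finite_has_maximal[OF fin this]
  obtain S where PS: "P S" and max: "\<And>S'. P S' \<Longrightarrow> S \<subseteq> S' \<Longrightarrow> S = S'" by auto
  then have S: "S \<subseteq> ?V" "conn_on ?E S" by (auto simp: P_def)
  obtain r par rk where o: "rooted_order ?E S r par rk" using PS unfolding P_def by blast
  have "S = ?V"
  proof (rule ccontr)
    assume ne: "S \<noteq> ?V"
    have "\<exists>a \<in> S. \<exists>z \<in> ?V. (a, z) \<in> ?E \<and> z \<notin> S"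
    proof (rule ccontr)
      assume none: "\<not> ?thesis"
      have "S = ?V"
      proof (rule conn_onD[OF conn(2)])
        show "r \<in> S" using o by (simp add: rooted_order_def)
        show "y \<in> S" if "x \<in> S" "y \<in> ?V" "(x, y) \<in> ?E" for x y using none that by blast
      qed (use S in blast)
      then show False using ne by blast
    qed
    then obtain a z where az: "a \<in> S" "z \<in> ?V" "(a, z) \<in> ?E" "z \<notin> S" by blast
    have uniq: "b = a" if "b \<in> S" "(b, z) \<in> ?E \<or> (z, b) \<in> ?E" for b
    proof (rule ccontr)
      assume "b \<noteq> a"
      moreover have "(z, a) \<in> ?E" "(z, b) \<in> ?E"
        using that az pair_graph_arcsD(4)[OF T] by blast+
      ultimately have "\<exists>p. pre_digraph.cycle (with_proj T) p \<and> 3 \<le> length p"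
        using cycle_through_outside_vertex[OF T, of S a b z] S az that by blast
      then show False using acyc by blast
    qed
    have zr: "z \<noteq> r" using o az(4) by (auto simp: rooted_order_def)
    have "rooted_order ?E (insert z S) r (par(z := a)) (rk(z := Suc (rk a)))"
      unfolding rooted_order_def
    proof (intro conjI ballI impI)
      show "r \<in> insert z S" using o by (simp add: rooted_order_def)
      fix x assume x: "x \<in> insert z S - {r}"
      show "(par(z := a)) x \<in> insert z S" using x o az by (auto simp: rooted_order_def)
      show "(rk(z := Suc (rk a))) ((par(z := a)) x) < (rk(z := Suc (rk a))) x"
      proof (cases "x = z")
        case True then show ?thesis using az by auto
      next
        case False
        then have "par x \<in> S" "rk (par x) < rk x" using x o by (auto simp: rooted_order_def)
        then show ?thesis using False az by auto
      qed
    next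
      fix x y assume xy: "x \<in> insert z S" "y \<in> insert z S" "(x, y) \<in> ?E"
      have "x \<noteq> y" using pair_graph_arcsD(3)[OF T xy(3)] .
      consider "x = z" "y \<in> S" | "y = z" "x \<in> S" | "x \<in> S" "y \<in> S" using xy \<open>x \<noteq> y\<close> by blast
      then show "x \<noteq> r \<and> y = (par(z := a)) x \<or> y \<noteq> r \<and> x = (par(z := a)) y"
      proof cases
        case 1 then show ?thesis using uniq[of y] xy(3) zr by simp
      next
        case 2 then show ?thesis using uniq[of x] xy(3) zr by simp
      next
        case 3
        then have "x \<noteq> z" "y \<noteq> z" using az by auto
        then show ?thesis using o 3 xy(3) unfolding rooted_order_def by simp
      qed
    qed
    moreover have "conn_on ?E (insert z S)"
    proof -
      have "touches ?E S {z}" using az unfolding touches_def by blast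
      then show ?thesis using conn_on_Un[OF sE _ conn_on_singleton, of S z] S by simp
    qed
    ultimately have "P (insert z S)" using S(1) az(2) unfolding P_def by blast
    then show False using max[of "insert z S"] az by blast
  qed
  then show ?thesis using o by blast
qed

text \<open>The pairs point towards the root, so \<open>(x, y)\<close> in the reflexive transitive
  closure means that \<open>y\<close> is \<open>x\<close> or an ancestor of
  \<open>x\<close>.\<close>

definition parent_rel :: "'n set \<Rightarrow> 'n \<Rightarrow> ('n \<Rightarrow> 'n) \<Rightarrow> ('n \<times> 'n) set" where
  "parent_rel S r par = {(x, par x) | x. x \<in> S \<and> x \<noteq> r}"

lemma parent_rel_rank:
  assumes "rooted_order E S r par rk" "(x, y) \<in> (parent_rel S r par)\<^sup>*"
  shows "x = y \<or> rk y < rk x"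
  using assms(2)
proof induction
  case (step y z)
  then have "rk z < rk y" using assms(1) by (auto simp: rooted_order_def parent_rel_def)
  then show ?case using step by auto
qed simp

lemma single_valued_parent_rel: "single_valued (parent_rel S r par)"
  by (auto simp: single_valued_def parent_rel_def)

text \<open>Otherwise \<open>x\<close> together with its descendants in \<open>M\<close> would be
  closed under the arcs in \<open>M\<close>. Then \<open>m\<close> would be a proper descendant of
  \<open>x\<close>, against the minimality of its rank.\<close>

lemma conn_on_parent_closed:
  assumes o: "rooted_order E S r par rk" and M: "M \<subseteq> S" "conn_on E M"
    and m: "m \<in> M" "\<And>x. x \<in> M \<Longrightarrow> rk m \<le> rk x" and x: "x \<in> M" "x \<noteq> m"
  shows "x \<noteq> r \<and> par x \<in> M"
proof (rule ccontr)
  assume neg: "\<not> ?thesis"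
  let ?R = "(parent_rel S r par)\<^sup>*"
  let ?Z = "{z \<in> M. (z, x) \<in> ?R}"
  have "?Z = M"
  proof (rule conn_onD[OF M(2)])
    show "x \<in> ?Z" using x by simp
    fix a b assume a: "a \<in> ?Z" and b: "b \<in> M" and ab: "(a, b) \<in> E"
    have "(a \<noteq> r \<and> b = par a) \<or> (b \<noteq> r \<and> a = par b)"
      using o a b ab M(1) unfolding rooted_order_def by blast
    then show "b \<in> ?Z"
    proof
      assume h: "a \<noteq> r \<and> b = par a"
      then have "a \<noteq> x" using neg b by blast
      then obtain c where "(a, c) \<in> parent_rel S r par" "(c, x) \<in> ?R"
        using a by (auto elim: converse_rtranclE)
      then show ?thesis using h b by (auto simp: parent_rel_def)
    next
      assume "b \<noteq> r \<and> a = par b"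
      then have "(b, a) \<in> parent_rel S r par" using b M(1) by (auto simp: parent_rel_def)
      then show ?thesis using a b by (auto intro: converse_rtrancl_into_rtrancl)
    qed
  qed blast
  then have "(m, x) \<in> ?R" using m(1) by blast
  then have "rk x < rk m" using parent_rel_rank[OF o] x(2) by metis
  then show False using m(2)[OF x(1)] by simp
qed

lemma conn_on_below_top:
  assumes o: "rooted_order E S r par rk" and M: "M \<subseteq> S" "conn_on E M"
    and m: "m \<in> M" "\<And>x. x \<in> M \<Longrightarrow> rk m \<le> rk x" and x: "x \<in> M"
  shows "(x, m) \<in> (parent_rel S r par)\<^sup>*"
  using x
proof (induction "rk x" arbitrary: x rule: less_induct)
  case less
  show ?case
  proof (cases "x = m")
    case False
    then have p: "x \<noteq> r" "par x \<in> M" using conn_on_parent_closed[OF o M m less.prems] by auto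
    moreover have "rk (par x) < rk x" using o p(1) less.prems M(1) by (auto simp: rooted_order_def)
    ultimately have "(par x, m) \<in> (parent_rel S r par)\<^sup>*" using less.hyps by blast
    moreover have "(x, par x) \<in> parent_rel S r par"
      using p less.prems M(1) by (auto simp: parent_rel_def)
    ultimately show ?thesis by (rule converse_rtrancl_into_rtrancl[rotated])
  qed simp
qed

text \<open>The topmost node \<open>m\<close> of \<open>M\<close> and the node \<open>y\<close> both
  lie on the way from \<open>i\<close> to the root, hence are comparable. If \<open>y\<close> comes
  first, it lies in \<open>M\<close>, and the condition on \<open>y\<close> forces
  \<open>y = m\<close>. So all of \<open>M\<close> is below \<open>m\<close>, which is below
  \<open>y\<close>.\<close>

lemma conn_on_below:
  assumes o: "rooted_order E S r par rk" and M: "M \<subseteq> S" "conn_on E M"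
    and i: "i \<in> M" "(i, y) \<in> (parent_rel S r par)\<^sup>*"
    and y: "y \<notin> M \<or> (\<forall>x \<in> M. rk y \<le> rk x)" and x: "x \<in> M"
  shows "(x, y) \<in> (parent_rel S r par)\<^sup>*"
proof -
  let ?R = "(parent_rel S r par)\<^sup>*"
  define m where "m = arg_min rk (\<lambda>x. x \<in> M)"
  have m: "m \<in> M" "\<And>x. x \<in> M \<Longrightarrow> rk m \<le> rk x"
    unfolding m_def using arg_min_natI[of "\<lambda>x. x \<in> M" i rk] arg_min_nat_le[of "\<lambda>x. x \<in> M" _ rk] i(1)
    by auto
  have im: "(i, m) \<in> ?R" by (rule conn_on_below_top[OF o M m i(1)])
  have between: "y \<in> M" if "(y, m) \<in> ?R"
    using i(2) that
  proof (induction rule: rtrancl_induct)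
    case (step z w)
    then have zw: "w = par z" "z \<in> S" "z \<noteq> r" by (auto simp: parent_rel_def)
    have "(z, m) \<in> ?R" using step by (auto intro: converse_rtrancl_into_rtrancl)
    then have zM: "z \<in> M" using step by blast
    have "rk w < rk z" using o zw by (auto simp: rooted_order_def)
    moreover have "rk m \<le> rk w" using parent_rel_rank[OF o step.prems] by auto
    ultimately have "z \<noteq> m" by auto
    then show ?case using conn_on_parent_closed[OF o M m zM] zw(1) by blast
  qed (use i in simp)
  have "(m, y) \<in> ?R \<or> (y, m) \<in> ?R"
    using single_valued_confluent[OF single_valued_parent_rel im i(2)] .
  then have "(m, y) \<in> ?R"
  proof
    assume ym: "(y, m) \<in> ?R"
    then have "rk y \<le> rk m" using between y m(1) by blast
    then have "y = m" using parent_rel_rank[OF o ym] by auto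
    then show ?thesis by simp
  qed
  then show ?thesis using conn_on_below_top[OF o M m x] by (rule rtrancl_trans[rotated])
qed

section \<open>Bags that hit families of connected sets\<close>

lemma tree_decomposition_nodes:
  assumes "tree_decomposition G T W" "v \<in> pverts G"
  shows "{x \<in> pverts T. v \<in> W x} \<noteq> {}" "conn_on (parcs T) {x \<in> pverts T. v \<in> W x}"
proof -
  have T: "pair_graph T" using assms unfolding tree_decomposition_def undirected_tree_def by blast
  show "{x \<in> pverts T. v \<in> W x} \<noteq> {}" "conn_on (parcs T) {x \<in> pverts T. v \<in> W x}"
    using assms connected_induce_iff[OF pair_graph_sym[OF T]] unfolding tree_decomposition_def by auto
qed

text \<open>
  Take a member of the family whose topmost tree node \<open>y\<close> is as deep as possible, and let \<open>Q\<close> be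
  its component in the part of \<open>D\<close> met by the bags below \<open>y\<close>. A member that meets \<open>Q\<close> but avoids
  \<open>W y\<close> in \<open>Q\<close> could not leave \<open>Q\<close> and would have its topmost node strictly below \<open>y\<close>.
\<close>

lemma bag_hitting_neighbours:
  fixes G :: "'a pair_pre_digraph" and T :: "'n pair_pre_digraph"
  assumes G: "pair_graph G" and td: "tree_decomposition G T W" and D: "D \<subseteq> pverts G"
    and up: "\<And>F F'. A F \<Longrightarrow> F \<subseteq> F' \<Longrightarrow> F' \<subseteq> D \<Longrightarrow> A F'"
    and F0: "F0 \<subseteq> D" "F0 \<noteq> {}" "conn_on (parcs G) F0" "A F0"
  shows "\<exists>Q y. Q \<subseteq> D \<and> conn_on (parcs G) Q \<and> A Q \<and> Q \<noteq> {} \<and> y \<in> pverts T \<and>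
    (\<forall>F. F \<subseteq> D \<and> conn_on (parcs G) F \<and> A F \<and> F \<inter> Q \<noteq> {} \<longrightarrow> F \<inter> Q \<inter> W y \<noteq> {})"
proof -
  let ?E = "parcs G" and ?S = "pverts T"
  have sE: "sym ?E" by (rule pair_graph_sym[OF G])
  have tree: "undirected_tree T" and edge: "\<And>v w. (v, w) \<in> ?E \<Longrightarrow> \<exists>x \<in> ?S. v \<in> W x \<and> w \<in> W x"
    using td unfolding tree_decomposition_def by auto
  obtain r par rk where o: "rooted_order (parcs T) ?S r par rk"
    using undirected_tree_rooted_order[OF tree] by blast
  let ?R = "(parent_rel ?S r par)\<^sup>*"
  define N where "N v = {x \<in> ?S. v \<in> W x}" for v
  have N: "N v \<noteq> {}" "N v \<subseteq> ?S" "conn_on (parcs T) (N v)" if "v \<in> D" for v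
    using tree_decomposition_nodes[OF td, of v] that D unfolding N_def by auto
  define good where "good F \<longleftrightarrow> F \<subseteq> D \<and> F \<noteq> {} \<and> conn_on ?E F \<and> A F" for F
  \<comment> \<open>A top of a good set is a node of minimal rank among those whose bags meet the
    set; the deepest top is the one of largest rank.\<close>
  define tops where "tops = {y \<in> ?S. \<exists>F. good F \<and> (\<exists>v \<in> F. y \<in> N v) \<and> (\<forall>v \<in> F. \<forall>x \<in> N v. rk y \<le> rk x)}"
  have top_ex: "\<exists>y \<in> tops. (\<exists>v \<in> F. y \<in> N v) \<and> (\<forall>v \<in> F. \<forall>x \<in> N v. rk y \<le> rk x)" if gF: "good F" for F
  proof -
    obtain v x where vx: "v \<in> F" "x \<in> N v" using gF N(1) unfolding good_def by blast
    define y where "y = arg_min rk (\<lambda>x. \<exists>v \<in> F. x \<in> N v)"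
    have "\<exists>v \<in> F. y \<in> N v"
      unfolding y_def by (rule arg_min_natI[of "\<lambda>x. \<exists>v \<in> F. x \<in> N v" x]) (use vx in blast)
    moreover have "\<forall>v \<in> F. \<forall>x \<in> N v. rk y \<le> rk x"
      unfolding y_def by (auto intro: arg_min_nat_le)
    ultimately show ?thesis using gF unfolding tops_def N_def by blast
  qed
  have "finite ?S" using pair_graph_finite tree unfolding undirected_tree_def by blast
  then have "finite tops" unfolding tops_def by simp
  moreover have "tops \<noteq> {}" using top_ex[of F0] F0 unfolding good_def by blast
  ultimately have fin: "finite (rk ` tops)" and "Max (rk ` tops) \<in> rk ` tops" by (simp_all add: Max_in)
  then obtain y where y1: "y \<in> tops" "Max (rk ` tops) = rk y" by blast
  have y: "y \<in> tops" "\<And>y'. y' \<in> tops \<Longrightarrow> rk y' \<le> rk y"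
    using y1 Max_ge[OF fin] by auto
  then obtain F1 v1 where F1: "good F1" "v1 \<in> F1" "y \<in> N v1" "\<And>v x. v \<in> F1 \<Longrightarrow> x \<in> N v \<Longrightarrow> rk y \<le> rk x"
    unfolding tops_def by blast
  have v1: "v1 \<in> D" using F1 by (auto simp: good_def)
  define Dy where "Dy = {v \<in> D. \<exists>x \<in> N v. (x, y) \<in> ?R}"
  define Q where "Q = comp_of ?E Dy v1"
  have v1y: "v1 \<in> Dy" using v1 F1(3) unfolding Dy_def by auto
  have QDy: "Q \<subseteq> Dy" unfolding Q_def by (rule comp_of_subset[OF v1y])
  then have QD: "Q \<subseteq> D" unfolding Dy_def by blast
  \<comment> \<open>Since \<open>y\<close> is a top of \<open>F1\<close>, the nodes of a vertex of
    \<open>F1\<close> lie all below \<open>y\<close> as soon as one does. Neighbours share a bag, so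
    membership in \<open>Dy\<close> spreads through \<open>F1\<close>.\<close>
  have "F1 \<inter> Dy = F1"
  proof (rule conn_onD[of ?E])
    show "conn_on ?E F1" using F1 by (simp add: good_def)
    show "v1 \<in> F1 \<inter> Dy" using F1 v1y by simp
    fix a b assume a: "a \<in> F1 \<inter> Dy" and b: "b \<in> F1" and ab: "(a, b) \<in> ?E"
    obtain x where x: "x \<in> N a" "x \<in> N b" using edge[OF ab] unfolding N_def by blast
    obtain i where i: "i \<in> N a" "(i, y) \<in> ?R" using a unfolding Dy_def by blast
    have aD: "a \<in> D" and bD: "b \<in> D" using a b F1(1) by (auto simp: good_def)
    have "(x, y) \<in> ?R"
      using conn_on_below[OF o N(2,3)[OF aD] i _ x(1)] F1(4) a by blast
    then show "b \<in> F1 \<inter> Dy" using b bD x unfolding Dy_def by blast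
  qed blast
  then have F1Q: "F1 \<subseteq> Q"
    using conn_on_subset_comp_of[of ?E F1 Dy v1 v1] F1 v1y unfolding Q_def good_def by auto
  have "A Q" using up[OF _ F1Q QD] F1 by (simp add: good_def)
  have hit: "F \<inter> Q \<inter> W y \<noteq> {}" if F: "F \<subseteq> D" "conn_on ?E F" "A F" "F \<inter> Q \<noteq> {}" for F
  proof
    assume no: "F \<inter> Q \<inter> W y = {}"
    obtain z where z: "z \<in> F" "z \<in> Q" using F(4) by blast
    \<comment> \<open>As \<open>y\<close> is not a node of \<open>a\<close>, all nodes of
      \<open>a\<close> are strictly below \<open>y\<close>. Hence no arc of \<open>F\<close> leads
      out of \<open>Q\<close>.\<close>
    have below: "(x, y) \<in> ?R \<and> x \<noteq> y" if a: "a \<in> F" "a \<in> Q" and x: "x \<in> N a" for a x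
    proof -
      have "y \<notin> N a" using no a unfolding N_def by blast
      moreover obtain i where "i \<in> N a" "(i, y) \<in> ?R" using a QDy unfolding Dy_def by blast
      moreover have "a \<in> D" using a F by blast
      ultimately show ?thesis using conn_on_below[OF o N(2,3) _ _ _ x, of i y] x by blast
    qed
    have FQ: "F \<inter> Q = F"
    proof (rule conn_onD[OF F(2)])
      show "z \<in> F \<inter> Q" using z by simp
      fix a b assume a: "a \<in> F \<inter> Q" and b: "b \<in> F" and ab: "(a, b) \<in> ?E"
      obtain x where x: "x \<in> N a" "x \<in> N b" using edge[OF ab] unfolding N_def by blast
      have "b \<in> Dy" using below[of a x] a b x F(1) unfolding Dy_def by blast
      then show "b \<in> F \<inter> Q" using comp_of_closed[of a ?E Dy v1 b] a b ab v1y unfolding Q_def by blast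
    qed blast
    have "good F" using F z unfolding good_def by blast
    then obtain y' v where y': "y' \<in> tops" "v \<in> F" "y' \<in> N v" using top_ex by blast
    then have "(y', y) \<in> ?R" "y' \<noteq> y" using below[of v y'] FQ by blast+
    then have "rk y < rk y'" using parent_rel_rank[OF o] by metis
    then show False using y(2)[OF y'(1)] by simp
  qed
  have "conn_on ?E Q" unfolding Q_def by (rule conn_on_comp_of[OF sE v1y])
  moreover have "Q \<noteq> {}" using F1Q F1(2) by blast
  moreover have "y \<in> ?S" using y(1) unfolding tops_def by blast
  ultimately show ?thesis using QD \<open>A Q\<close> hit by blast
qed

text \<open>Induction on \<open>t\<close>: let \<open>Q\<close> be a member of the family and
  \<open>W y\<close> a bag that hits every member meeting \<open>Q\<close>, and apply the hypothesis
  to \<open>D - Q\<close>. Either \<open>Q\<close> joins \<open>t\<close> disjoint sets found there,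
  or \<open>y\<close> joins fewer than \<open>t\<close> nodes.\<close>

lemma disjoint_sets_or_hitting_bags:
  fixes G :: "'a pair_pre_digraph" and T :: "'n pair_pre_digraph"
  assumes G: "pair_graph G" and td: "tree_decomposition G T W" and D: "D \<subseteq> pverts G"
    and up: "\<And>F F'. A F \<Longrightarrow> F \<subseteq> F' \<Longrightarrow> F' \<subseteq> D \<Longrightarrow> A F'"
  shows "(\<exists>f :: nat \<Rightarrow> 'a set. (\<forall>k < t. f k \<subseteq> D \<and> f k \<noteq> {} \<and> conn_on (parcs G) (f k) \<and> A (f k)) \<and>
      (\<forall>k < t. \<forall>l < t. k \<noteq> l \<longrightarrow> f k \<inter> f l = {})) \<or>
    (\<exists>Y \<subseteq> pverts T. finite Y \<and> card Y < t \<and>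
      (\<forall>F. F \<subseteq> D \<and> F \<noteq> {} \<and> conn_on (parcs G) F \<and> A F \<longrightarrow> F \<inter> \<Union>(W ` Y) \<noteq> {}))"
  using D up
proof (induction t arbitrary: D)
  case (Suc t)
  show ?case
  proof (cases "\<exists>F. F \<subseteq> D \<and> F \<noteq> {} \<and> conn_on (parcs G) F \<and> A F")
    case False
    then show ?thesis by (intro disjI2 exI[of _ "{}"]) auto
  next
    case True
    then obtain F0 where F0: "F0 \<subseteq> D" "F0 \<noteq> {}" "conn_on (parcs G) F0" "A F0" by blast
    obtain Q y where Q: "Q \<subseteq> D" "conn_on (parcs G) Q" "A Q" "Q \<noteq> {}" "y \<in> pverts T"
      and hit: "\<And>F. F \<subseteq> D \<Longrightarrow> conn_on (parcs G) F \<Longrightarrow> A F \<Longrightarrow> F \<inter> Q \<noteq> {} \<Longrightarrow> F \<inter> Q \<inter> W y \<noteq> {}"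
      using bag_hitting_neighbours[OF G td Suc.prems(1), of A F0] Suc.prems(2) F0 by metis
    have "D - Q \<subseteq> pverts G" using Suc.prems(1) by blast
    moreover have "A F'" if "A F" "F \<subseteq> F'" "F' \<subseteq> D - Q" for F F'
      using Suc.prems(2) that by blast
    ultimately have IH: "(\<exists>f :: nat \<Rightarrow> 'a set. (\<forall>k < t. f k \<subseteq> D - Q \<and> f k \<noteq> {} \<and> conn_on (parcs G) (f k) \<and> A (f k)) \<and>
      (\<forall>k < t. \<forall>l < t. k \<noteq> l \<longrightarrow> f k \<inter> f l = {})) \<or>
    (\<exists>Y \<subseteq> pverts T. finite Y \<and> card Y < t \<and>
      (\<forall>F. F \<subseteq> D - Q \<and> F \<noteq> {} \<and> conn_on (parcs G) F \<and> A F \<longrightarrow> F \<inter> \<Union>(W ` Y) \<noteq> {}))"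
      by (rule Suc.IH)
    consider
      (many) f where "\<forall>k < t. f k \<subseteq> D - Q \<and> f k \<noteq> {} \<and> conn_on (parcs G) (f k) \<and> A (f k)"
        "\<forall>k < t. \<forall>l < t. k \<noteq> l \<longrightarrow> f k \<inter> f l = {}"
      | (few) Y where "Y \<subseteq> pverts T" "finite Y" "card Y < t"
        "\<forall>F. F \<subseteq> D - Q \<and> F \<noteq> {} \<and> conn_on (parcs G) F \<and> A F \<longrightarrow> F \<inter> \<Union>(W ` Y) \<noteq> {}"
      using IH by (elim disjE exE conjE) metis+
    then show ?thesis
    proof cases
      case many
      let ?f = "f(t := Q)"
      have "\<forall>k < Suc t. ?f k \<subseteq> D \<and> ?f k \<noteq> {} \<and> conn_on (parcs G) (?f k) \<and> A (?f k)"
      proof (intro allI impI)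
        fix k assume "k < Suc t"
        then consider "k < t" | "k = t" by linarith
        then show "?f k \<subseteq> D \<and> ?f k \<noteq> {} \<and> conn_on (parcs G) (?f k) \<and> A (?f k)"
        proof cases
          case 1
          then have "f k \<subseteq> D - Q \<and> f k \<noteq> {} \<and> conn_on (parcs G) (f k) \<and> A (f k)" using many(1) by blast
          then show ?thesis using 1 by auto
        qed (use Q in simp)
      qed
      moreover have "\<forall>k < Suc t. \<forall>l < Suc t. k \<noteq> l \<longrightarrow> ?f k \<inter> ?f l = {}"
      proof (intro allI impI)
        fix k l assume kl: "k < Suc t" "l < Suc t" "k \<noteq> l"
        consider "k < t" "l < t" | "k = t" "l < t" | "k < t" "l = t" using kl by linarith
        then show "?f k \<inter> ?f l = {}"
        proof cases
          case 1 then show ?thesis using many(2) kl(3) by simp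
        next
          case 2
          then have "f l \<subseteq> D - Q" using many(1) by blast
          then show ?thesis using 2 by auto
        next
          case 3
          then have "f k \<subseteq> D - Q" using many(1) by blast
          then show ?thesis using 3 by auto
        qed
      qed
      ultimately show ?thesis by blast
    next
      case few
      have "F \<inter> \<Union>(W ` insert y Y) \<noteq> {}"
        if "F \<subseteq> D" "F \<noteq> {}" "conn_on (parcs G) F" "A F" for F
      proof (cases "F \<inter> Q = {}")
        case True
        then have "F \<subseteq> D - Q" using that(1) by blast
        then have "F \<inter> \<Union>(W ` Y) \<noteq> {}" using few(4)[rule_format, of F] that(2-4) by simp
        then show ?thesis by auto
      next
        case False
        then show ?thesis using hit[OF that(1,3,4)] by auto
      qed
      moreover have "card (insert y Y) < Suc t" using few(2,3) by (simp add: card_insert_if)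
      moreover have "insert y Y \<subseteq> pverts T" "finite (insert y Y)" using few(1,2) Q(5) by auto
      ultimately have "\<exists>Y \<subseteq> pverts T. finite Y \<and> card Y < Suc t \<and>
        (\<forall>F. F \<subseteq> D \<and> F \<noteq> {} \<and> conn_on (parcs G) F \<and> A F \<longrightarrow> F \<inter> \<Union>(W ` Y) \<noteq> {})"
        by (intro exI[of _ "insert y Y"] conjI allI impI; (elim conjE)?; simp only: not_False_eq_True)
      then show ?thesis by (rule disjI2)
    qed
  qed
qed simp

section \<open>Minimal hitting sets and the choice of a new part\<close>

text \<open>Elements are discarded while the rest still hits every member of \<open>H\<close>. An
  element that cannot be discarded is the only one in some member; \<open>reach_branch_set\<close>
  starts from this private member.\<close>

lemma minimal_hitting_set:
  assumes "finite X" "\<And>F. F \<in> H \<Longrightarrow> F \<inter> X \<noteq> {}"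
  shows "\<exists>X' \<subseteq> X. (\<forall>F \<in> H. F \<inter> X' \<noteq> {}) \<and> (\<forall>x \<in> X'. \<exists>F \<in> H. F \<inter> X' = {x})"
  using assms
proof (induction X rule: finite_psubset_induct)
  case (psubset X)
  show ?case
  proof (cases "\<forall>x \<in> X. \<exists>F \<in> H. F \<inter> X = {x}")
    case True then show ?thesis using psubset.prems by blast
  next
    case False
    then obtain x where x: "x \<in> X" "\<And>F. F \<in> H \<Longrightarrow> F \<inter> X \<noteq> {x}" by blast
    have "F \<inter> (X - {x}) \<noteq> {}" if "F \<in> H" for F using x(2)[OF that] psubset.prems[OF that] x(1) by blast
    then obtain X' where "X' \<subseteq> X - {x}" "\<forall>F \<in> H. F \<inter> X' \<noteq> {}" "\<forall>x \<in> X'. \<exists>F \<in> H. F \<inter> X' = {x}"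
      using psubset.IH[of "X - {x}"] x(1) by blast
    then show ?thesis by blast
  qed
qed

text \<open>In the recursion the indices are numbers of parts. A branch set need not be the part
  itself: it has to contain the neighbours of \<open>D\<close> in that part, see
  \<open>fits\<close>.\<close>

definition clique_model :: "'a pair_pre_digraph \<Rightarrow> nat set \<Rightarrow> (nat \<Rightarrow> 'a set) \<Rightarrow> bool" where
  "clique_model G K V \<longleftrightarrow> finite K \<and>
    (\<forall>i \<in> K. V i \<subseteq> pverts G \<and> V i \<noteq> {} \<and> conn_on (parcs G) (V i)) \<and>
    (\<forall>i \<in> K. \<forall>j \<in> K. i \<noteq> j \<longrightarrow> V i \<inter> V j = {} \<and> touches (parcs G) (V i) (V j))"

definition linked :: "'a pair_pre_digraph \<Rightarrow> nat set \<Rightarrow> (nat \<Rightarrow> 'a set) \<Rightarrow> 'a set \<Rightarrow> bool" where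
  "linked G K V F \<longleftrightarrow> F \<noteq> {} \<and> conn_on (parcs G) F \<and> (\<forall>i \<in> K. touches (parcs G) F (V i))"

text \<open>
  The new part \<open>X\<close> is a minimal hitting set: of all linked subsets of \<open>D\<close> if the clique is full, and
  otherwise only of those that meet \<open>Q\<close>. In the latter case \<open>Q\<close> becomes the branch set of the new
  clique vertex for the components of \<open>D - X\<close> that are still linked to the whole clique.
\<close>

lemma new_part_exists:
  fixes G :: "'a pair_pre_digraph" and T :: "'n pair_pre_digraph"
  assumes G: "pair_graph G" and td: "tree_decomposition G T W" and free: "Kstar_minor_free s t G"
    and t: "2 \<le> t" and D: "D \<subseteq> pverts G"
    and model: "clique_model G K V" and VD: "\<forall>i \<in> K. V i \<inter> D = {}" and K: "card K \<le> s"
    and F0: "F0 \<subseteq> D" "linked G K V F0"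
  shows "\<exists>X Q Y. X \<noteq> {} \<and> X \<subseteq> D \<and> Y \<subseteq> pverts T \<and> finite Y \<and> card Y \<le> t - 1 \<and> X \<subseteq> \<Union>(W ` Y) \<and>
    (\<forall>x \<in> X. \<exists>F \<subseteq> D. linked G K V F \<and> F \<inter> X = {x}) \<and>
    (\<forall>F \<subseteq> D - X. linked G K V F \<longrightarrow> card K < s \<and> F \<inter> Q = {}) \<and>
    (card K < s \<longrightarrow> X \<subseteq> Q \<and> Q \<subseteq> D \<and> linked G K V Q)"
proof -
  let ?E = "parcs G"
  define A where "A F \<longleftrightarrow> (\<forall>i \<in> K. touches ?E F (V i))" for F
  have up: "A F'" if "A F" "F \<subseteq> F'" "F' \<subseteq> D" for F F'
    using that touches_mono[of ?E F _ F'] unfolding A_def by blast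
  have lk: "linked G K V F \<longleftrightarrow> F \<noteq> {} \<and> conn_on ?E F \<and> A F" for F
    unfolding linked_def A_def by blast
  have finD: "finite D" using finite_subset[OF D pair_graph_finite[OF G]] .
  show ?thesis
  proof (cases "card K < s")
    case True
    have "\<exists>Q y. Q \<subseteq> D \<and> conn_on ?E Q \<and> A Q \<and> Q \<noteq> {} \<and> y \<in> pverts T \<and>
      (\<forall>F. F \<subseteq> D \<and> conn_on ?E F \<and> A F \<and> F \<inter> Q \<noteq> {} \<longrightarrow> F \<inter> Q \<inter> W y \<noteq> {})"
      by (rule bag_hitting_neighbours[OF G td D, of A F0]) (use up F0 lk in auto)
    then obtain Q y where Q: "Q \<subseteq> D" "conn_on ?E Q" "A Q" "Q \<noteq> {}" "y \<in> pverts T"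
      and hit: "\<And>F. F \<subseteq> D \<and> conn_on ?E F \<and> A F \<and> F \<inter> Q \<noteq> {} \<Longrightarrow> F \<inter> Q \<inter> W y \<noteq> {}"
      by metis
    define H where "H = {F. F \<subseteq> D \<and> linked G K V F \<and> F \<inter> Q \<noteq> {}}"
    have "finite (Q \<inter> W y)" using finite_subset[OF Q(1) finD] by simp
    moreover have "F \<inter> (Q \<inter> W y) \<noteq> {}" if "F \<in> H" for F
      using hit[of F] that lk[of F] by (simp add: H_def Int_assoc)
    ultimately obtain X where X: "X \<subseteq> Q \<inter> W y" "\<forall>F \<in> H. F \<inter> X \<noteq> {}"
      "\<forall>x \<in> X. \<exists>F \<in> H. F \<inter> X = {x}"
      using minimal_hitting_set[of "Q \<inter> W y" H] by blast
    have QH: "Q \<in> H" using Q lk by (auto simp: H_def)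
    then have "X \<noteq> {}" using X(2) by blast
    moreover have "\<forall>F \<subseteq> D - X. linked G K V F \<longrightarrow> card K < s \<and> F \<inter> Q = {}"
    proof (intro allI impI)
      fix F assume F: "F \<subseteq> D - X" "linked G K V F"
      then have "F \<inter> X = {}" "F \<subseteq> D" by blast+
      then show "card K < s \<and> F \<inter> Q = {}" using X(2) F(2) True unfolding H_def by blast
    qed
    moreover have "\<forall>x \<in> X. \<exists>F \<subseteq> D. linked G K V F \<and> F \<inter> X = {x}" using X(3) unfolding H_def by blast
    moreover have "X \<subseteq> Q" "X \<subseteq> D" "X \<subseteq> \<Union>(W ` {y})" using X(1) Q(1) by auto
    \<comment> \<open>A single bag is within the budget \<open>t - 1\<close> because
      \<open>2 \<le> t\<close>.\<close>
    moreover have "{y} \<subseteq> pverts T" "finite {y}" "card {y} \<le> t - 1" using Q(5) t by auto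
    moreover have "Q \<subseteq> D" "linked G K V Q" using QH by (auto simp: H_def)
    ultimately show ?thesis by blast
  next
    case False
    then have Ks: "card K = s" using K by simp
    \<comment> \<open>With the \<open>s\<close> branch sets, \<open>t\<close> disjoint linked
      subsets of \<open>D\<close> would form a model of the forbidden minor.\<close>
    have "\<not> (\<exists>f :: nat \<Rightarrow> 'a set. (\<forall>k < t. f k \<subseteq> D \<and> f k \<noteq> {} \<and> conn_on ?E (f k) \<and> A (f k)) \<and>
      (\<forall>k < t. \<forall>l < t. k \<noteq> l \<longrightarrow> f k \<inter> f l = {}))"
    proof
      assume "\<exists>f :: nat \<Rightarrow> 'a set. (\<forall>k < t. f k \<subseteq> D \<and> f k \<noteq> {} \<and> conn_on ?E (f k) \<and> A (f k)) \<and>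
        (\<forall>k < t. \<forall>l < t. k \<noteq> l \<longrightarrow> f k \<inter> f l = {})"
      then obtain f where f: "\<And>k. k < t \<Longrightarrow> f k \<subseteq> D \<and> f k \<noteq> {} \<and> conn_on ?E (f k) \<and> A (f k)"
        and fd: "\<And>k l. k < t \<Longrightarrow> l < t \<Longrightarrow> k \<noteq> l \<Longrightarrow> f k \<inter> f l = {}" by metis
      have "\<not> Kstar_minor_free s t G"
      proof (rule Kstar_minor_model[OF G _ Ks, of V t f])
        show "finite K" using model by (simp add: clique_model_def)
        show "V i \<subseteq> pverts G \<and> V i \<noteq> {} \<and> conn_on ?E (V i)" if "i \<in> K" for i
          using model that by (simp add: clique_model_def)
        show "V i \<inter> V j = {}" "touches ?E (V i) (V j)" if "i \<in> K" "j \<in> K" "i \<noteq> j" for i j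
          using model that by (simp_all add: clique_model_def)
        show "f k \<subseteq> pverts G \<and> f k \<noteq> {} \<and> conn_on ?E (f k)" if "k < t" for k
          using f[OF that] D by auto
        show "f k \<inter> V i = {} \<and> touches ?E (f k) (V i)" if "k < t" "i \<in> K" for k i
          using f[OF that(1)] bspec[OF VD that(2)] that(2) unfolding A_def by blast
      qed (use fd in auto)
      then show False using free by blast
    qed
    moreover have "(\<exists>f :: nat \<Rightarrow> 'a set. (\<forall>k < t. f k \<subseteq> D \<and> f k \<noteq> {} \<and> conn_on ?E (f k) \<and> A (f k)) \<and>
      (\<forall>k < t. \<forall>l < t. k \<noteq> l \<longrightarrow> f k \<inter> f l = {})) \<or>
      (\<exists>Y \<subseteq> pverts T. finite Y \<and> card Y < t \<and>
      (\<forall>F. F \<subseteq> D \<and> F \<noteq> {} \<and> conn_on ?E F \<and> A F \<longrightarrow> F \<inter> \<Union>(W ` Y) \<noteq> {}))"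
      by (rule disjoint_sets_or_hitting_bags[OF G td D]) (rule up)
    ultimately have "\<exists>Y \<subseteq> pverts T. finite Y \<and> card Y < t \<and>
      (\<forall>F. F \<subseteq> D \<and> F \<noteq> {} \<and> conn_on ?E F \<and> A F \<longrightarrow> F \<inter> \<Union>(W ` Y) \<noteq> {})"
      by (simp only: simp_thms)
    then obtain Y where Y: "Y \<subseteq> pverts T" "finite Y" "card Y < t"
      and hit: "\<And>F. F \<subseteq> D \<and> F \<noteq> {} \<and> conn_on ?E F \<and> A F \<Longrightarrow> F \<inter> \<Union>(W ` Y) \<noteq> {}" by metis
    define H where "H = {F. F \<subseteq> D \<and> linked G K V F}"
    have "F \<inter> (D \<inter> \<Union>(W ` Y)) \<noteq> {}" if "F \<in> H" for F
    proof -
      have "F \<subseteq> D" using that by (simp add: H_def)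
      then have "F \<inter> (D \<inter> \<Union>(W ` Y)) = F \<inter> \<Union>(W ` Y)" by blast
      then show ?thesis using hit[of F] that lk[of F] by (simp add: H_def)
    qed
    then obtain X where X: "X \<subseteq> D \<inter> \<Union>(W ` Y)" "\<forall>F \<in> H. F \<inter> X \<noteq> {}"
      "\<forall>x \<in> X. \<exists>F \<in> H. F \<inter> X = {x}"
      using minimal_hitting_set[of "D \<inter> \<Union>(W ` Y)" H] finD by blast
    have "X \<noteq> {}" using X(2) F0 unfolding H_def by blast
    \<comment> \<open>Vacuous, as \<open>X\<close> hits every linked subset of \<open>D\<close>; so
      \<open>{}\<close> can stand for \<open>Q\<close>.\<close>
    moreover have "\<forall>F \<subseteq> D - X. linked G K V F \<longrightarrow> card K < s \<and> F \<inter> {} = {}"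
    proof (intro allI impI)
      fix F assume F: "F \<subseteq> D - X" "linked G K V F"
      then have "F \<inter> X = {}" "F \<subseteq> D" by blast+
      then show "card K < s \<and> F \<inter> {} = {}" using X(2) F(2) unfolding H_def by blast
    qed
    moreover have "\<forall>x \<in> X. \<exists>F \<subseteq> D. linked G K V F \<and> F \<inter> X = {x}" using X(3) unfolding H_def by blast
    moreover have "X \<subseteq> D" "X \<subseteq> \<Union>(W ` Y)" using X(1) by auto
    moreover have "card Y \<le> t - 1" using Y(3) by simp
    ultimately show ?thesis using Y(1,2) False by blast
  qed
qed

section \<open>The partition\<close>

text \<open>
  Parts are numbered in order of creation, and part \<open>i\<close> is at the same time a node of a tree with
  bag \<open>insert i (earlier i)\<close>; parts may be empty. The vertices in \<open>rest\<close> are not assigned yet, and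
  their \<open>label\<close> is junk.
\<close>

record 'a partial_partition =
  size_of :: nat
  parent :: "nat \<Rightarrow> nat"
  earlier :: "nat \<Rightarrow> nat set"
  label :: "'a \<Rightarrow> nat"
  rest :: "'a set"

section \<open>Invariants of partial partitions\<close>

locale Kstar_free_decomposed =
  fixes G :: "'a pair_pre_digraph" and T :: "'n pair_pre_digraph" and W :: "'n \<Rightarrow> 'a set"
    and s t :: nat
  assumes G: "pair_graph G" and td: "tree_decomposition G T W"
    and free: "Kstar_minor_free s t G" and t: "2 \<le> t"
begin

abbreviation "E \<equiv> parcs G"

lemma sE: "sym E" by (rule pair_graph_sym[OF G])

text \<open>That \<open>earlier i\<close> lies in the bag of the parent of \<open>i\<close> makes
  the bags a tree-decomposition. Injectivity on sets of size \<open>s\<close> yields simplicity. The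
  last three conditions concern assigned vertices: their labels are in range, each part is covered
  by at most \<open>t - 1\<close> bags of \<open>W\<close>, and arcs stay within a part or join
  adjacent parts.\<close>

definition valid :: "'a partial_partition \<Rightarrow> bool" where
  "valid \<sigma> \<longleftrightarrow> 0 < size_of \<sigma> \<and> earlier \<sigma> 0 = {} \<and>
    (\<forall>i < size_of \<sigma>. 0 < i \<longrightarrow>
      parent \<sigma> i < i \<and> earlier \<sigma> i \<subseteq> insert (parent \<sigma> i) (earlier \<sigma> (parent \<sigma> i))) \<and>
    (\<forall>i < size_of \<sigma>. finite (earlier \<sigma> i) \<and> card (earlier \<sigma> i) \<le> s) \<and>
    inj_on (earlier \<sigma>) {i. i < size_of \<sigma> \<and> card (earlier \<sigma> i) = s} \<and>
    (\<forall>u \<in> pverts G - rest \<sigma>. label \<sigma> u < size_of \<sigma>) \<and>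
    (\<forall>i < size_of \<sigma>. \<exists>Y \<subseteq> pverts T. finite Y \<and> card Y \<le> t - 1 \<and>
      {u \<in> pverts G - rest \<sigma>. label \<sigma> u = i} \<subseteq> \<Union>(W ` Y)) \<and>
    (\<forall>u w. (u, w) \<in> E \<longrightarrow> u \<notin> rest \<sigma> \<longrightarrow> w \<notin> rest \<sigma> \<longrightarrow>
      label \<sigma> u = label \<sigma> w \<or> label \<sigma> u \<in> earlier \<sigma> (label \<sigma> w) \<or> label \<sigma> w \<in> earlier \<sigma> (label \<sigma> u))"

text \<open>
  The last conjunct guarantees that solving one subproblem does not use up an \<open>s\<close>-set that another
  subproblem still needs, since every such set may occur as \<open>earlier i\<close> only once.
\<close>

definition extends ::
    "'a partial_partition \<Rightarrow> 'a partial_partition \<Rightarrow> nat set set \<Rightarrow> 'a set \<Rightarrow> bool" where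
  "extends \<sigma> \<sigma>' \<K> D \<longleftrightarrow> size_of \<sigma> \<le> size_of \<sigma>' \<and>
    (\<forall>i < size_of \<sigma>. earlier \<sigma>' i = earlier \<sigma> i) \<and>
    (\<forall>u \<in> pverts G - rest \<sigma>. label \<sigma>' u = label \<sigma> u) \<and>
    rest \<sigma>' = rest \<sigma> - D \<and>
    (\<forall>i. size_of \<sigma> \<le> i \<and> i < size_of \<sigma>' \<and> card (earlier \<sigma>' i) = s \<longrightarrow>
      earlier \<sigma>' i \<in> \<K> \<or> \<not> earlier \<sigma>' i \<subseteq> {..<size_of \<sigma>})"

definition fits :: "'a partial_partition \<Rightarrow> 'a set \<Rightarrow> nat set \<Rightarrow> (nat \<Rightarrow> 'a set) \<Rightarrow> bool" where
  "fits \<sigma> D K V \<longleftrightarrow> D \<subseteq> rest \<sigma> \<and> (\<exists>q < size_of \<sigma>. K \<subseteq> insert q (earlier \<sigma> q)) \<and>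
    (card K = s \<longrightarrow> K \<notin> earlier \<sigma> ` {..<size_of \<sigma>}) \<and>
    (\<forall>u \<in> D. \<forall>w. (u, w) \<in> E \<longrightarrow> w \<notin> D \<longrightarrow> w \<notin> rest \<sigma> \<and> label \<sigma> w \<in> K \<and> w \<in> V (label \<sigma> w))"

text \<open>Quantifying over \<open>\<sigma>\<close> allows subproblems to be solved one after
  another, each starting from the partition that the previous ones leave.\<close>

definition solvable :: "'a set \<Rightarrow> nat set \<Rightarrow> (nat \<Rightarrow> 'a set) \<Rightarrow> bool" where
  "solvable D K V \<longleftrightarrow>
    (\<forall>\<sigma>. valid \<sigma> \<longrightarrow> fits \<sigma> D K V \<longrightarrow> (\<exists>\<sigma>'. valid \<sigma>' \<and> extends \<sigma> \<sigma>' {K} D))"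

lemma validD:
  assumes "valid \<sigma>"
  shows "0 < size_of \<sigma>" "earlier \<sigma> 0 = {}"
    "\<And>i. i < size_of \<sigma> \<Longrightarrow> 0 < i \<Longrightarrow> parent \<sigma> i < i"
    "\<And>i. i < size_of \<sigma> \<Longrightarrow> 0 < i \<Longrightarrow> earlier \<sigma> i \<subseteq> insert (parent \<sigma> i) (earlier \<sigma> (parent \<sigma> i))"
    "\<And>i. i < size_of \<sigma> \<Longrightarrow> finite (earlier \<sigma> i)" "\<And>i. i < size_of \<sigma> \<Longrightarrow> card (earlier \<sigma> i) \<le> s"
    "inj_on (earlier \<sigma>) {i. i < size_of \<sigma> \<and> card (earlier \<sigma> i) = s}"
    "\<And>u. u \<in> pverts G \<Longrightarrow> u \<notin> rest \<sigma> \<Longrightarrow> label \<sigma> u < size_of \<sigma>"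
    "\<And>i. i < size_of \<sigma> \<Longrightarrow> \<exists>Y \<subseteq> pverts T. finite Y \<and> card Y \<le> t - 1 \<and>
      {u \<in> pverts G - rest \<sigma>. label \<sigma> u = i} \<subseteq> \<Union>(W ` Y)"
    "\<And>u w. (u, w) \<in> E \<Longrightarrow> u \<notin> rest \<sigma> \<Longrightarrow> w \<notin> rest \<sigma> \<Longrightarrow>
      label \<sigma> u = label \<sigma> w \<or> label \<sigma> u \<in> earlier \<sigma> (label \<sigma> w) \<or> label \<sigma> w \<in> earlier \<sigma> (label \<sigma> u)"
  using assms unfolding valid_def by blast+

lemma extendsD:
  assumes "extends \<sigma> \<sigma>' \<K> D"
  shows "size_of \<sigma> \<le> size_of \<sigma>'" "\<And>i. i < size_of \<sigma> \<Longrightarrow> earlier \<sigma>' i = earlier \<sigma> i"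
    "\<And>u. u \<in> pverts G \<Longrightarrow> u \<notin> rest \<sigma> \<Longrightarrow> label \<sigma>' u = label \<sigma> u" "rest \<sigma>' = rest \<sigma> - D"
    "\<And>i. size_of \<sigma> \<le> i \<Longrightarrow> i < size_of \<sigma>' \<Longrightarrow> card (earlier \<sigma>' i) = s \<Longrightarrow>
      earlier \<sigma>' i \<in> \<K> \<or> \<not> earlier \<sigma>' i \<subseteq> {..<size_of \<sigma>}"
  using assms unfolding extends_def by auto

lemma fitsD:
  assumes "fits \<sigma> D K V"
  shows "D \<subseteq> rest \<sigma>" "\<exists>q < size_of \<sigma>. K \<subseteq> insert q (earlier \<sigma> q)"
    "card K = s \<Longrightarrow> K \<notin> earlier \<sigma> ` {..<size_of \<sigma>}"
    "\<And>u w. u \<in> D \<Longrightarrow> (u, w) \<in> E \<Longrightarrow> w \<notin> D \<Longrightarrow> w \<notin> rest \<sigma> \<and> label \<sigma> w \<in> K \<and> w \<in> V (label \<sigma> w)"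
  using assms unfolding fits_def by auto

lemma earlier_less:
  assumes "valid \<sigma>" "i < size_of \<sigma>"
  shows "earlier \<sigma> i \<subseteq> {..<i}"
  using assms(2)
proof (induction i rule: less_induct)
  case (less i)
  show ?case
  proof (cases "i = 0")
    case True then show ?thesis using validD(2)[OF assms(1)] by simp
  next
    case False
    then have p: "parent \<sigma> i < i" "earlier \<sigma> i \<subseteq> insert (parent \<sigma> i) (earlier \<sigma> (parent \<sigma> i))"
      using validD(3,4)[OF assms(1) less.prems] by auto
    then have "earlier \<sigma> (parent \<sigma> i) \<subseteq> {..<parent \<sigma> i}" using less by simp
    then show ?thesis using p by (meson insert_subset lessThan_iff lessThan_subset_iff less_imp_le order_trans)
  qed
qed

lemma fits_less:
  assumes "valid \<sigma>" "fits \<sigma> D K V"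
  shows "K \<subseteq> {..<size_of \<sigma>}"
proof -
  obtain q where q: "q < size_of \<sigma>" "K \<subseteq> insert q (earlier \<sigma> q)" using fitsD(2)[OF assms(2)] by blast
  have "earlier \<sigma> q \<subseteq> {..<q}" by (rule earlier_less[OF assms(1) q(1)])
  then show ?thesis using q by (auto dest!: subsetD)
qed

lemma extends_refl: "extends \<sigma> \<sigma> {} {}"
  unfolding extends_def by auto

lemma extends_trans:
  assumes "extends \<sigma> \<sigma>1 \<K>1 D1" "extends \<sigma>1 \<sigma>2 \<K>2 D2"
  shows "extends \<sigma> \<sigma>2 (\<K>1 \<union> \<K>2) (D1 \<union> D2)"
  unfolding extends_def
proof (intro conjI allI ballI impI)
  note 1 = extendsD[OF assms(1)] and 2 = extendsD[OF assms(2)]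
  show "size_of \<sigma> \<le> size_of \<sigma>2" using 1(1) 2(1) by simp
  show "earlier \<sigma>2 i = earlier \<sigma> i" if "i < size_of \<sigma>" for i using 1(1) 1(2)[of i] 2(2)[of i] that by simp
  show "label \<sigma>2 u = label \<sigma> u" if "u \<in> pverts G - rest \<sigma>" for u
    using 1(3)[of u] 2(3)[of u] 1(4) that by simp
  show "rest \<sigma>2 = rest \<sigma> - (D1 \<union> D2)" using 1(4) 2(4) by blast
  fix i assume i: "size_of \<sigma> \<le> i \<and> i < size_of \<sigma>2 \<and> card (earlier \<sigma>2 i) = s"
  show "earlier \<sigma>2 i \<in> \<K>1 \<union> \<K>2 \<or> \<not> earlier \<sigma>2 i \<subseteq> {..<size_of \<sigma>}"
  proof (cases "i < size_of \<sigma>1")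
    case True
    then show ?thesis using 1(5)[of i] 2(2)[of i] i by auto
  next
    case False
    then have "earlier \<sigma>2 i \<in> \<K>2 \<or> \<not> earlier \<sigma>2 i \<subseteq> {..<size_of \<sigma>1}" using 2(5)[of i] i by simp
    then show ?thesis using 1(1) by auto
  qed
qed

text \<open>\<open>extends\<close> restricts only \<open>earlier\<close> sets of size
  \<open>s\<close> made of old numbers, so all other sets may be dropped from
  \<open>\<K>\<close>.\<close>

lemma extends_weaken:
  assumes "extends \<sigma> \<sigma>' \<K> D"
    "\<And>K. K \<in> \<K> \<Longrightarrow> card K = s \<Longrightarrow> K \<subseteq> {..<size_of \<sigma>} \<Longrightarrow> K \<in> \<K>'"
  shows "extends \<sigma> \<sigma>' \<K>' D"
  using assms unfolding extends_def by blast

text \<open>Old labels and old \<open>earlier\<close> sets do not change. Since \<open>K\<close>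
  consists of old numbers, a new node could use it as \<open>earlier\<close> set only if it belonged
  to \<open>\<K>\<close>.\<close>

lemma fits_extends:
  assumes v: "valid \<sigma>" and f: "fits \<sigma> D K V" and x: "extends \<sigma> \<sigma>' \<K> D'"
    and d: "D \<inter> D' = {}" and K: "card K = s \<Longrightarrow> K \<notin> \<K>"
  shows "fits \<sigma>' D K V"
  unfolding fits_def
proof (intro conjI ballI allI impI)
  note x = extendsD[OF x] and f' = fitsD[OF f]
  show "D \<subseteq> rest \<sigma>'" using f'(1) x(4) d by blast
  obtain q where q: "q < size_of \<sigma>" "K \<subseteq> insert q (earlier \<sigma> q)" using f'(2) by blast
  then show "\<exists>q < size_of \<sigma>'. K \<subseteq> insert q (earlier \<sigma>' q)"
    using x(1,2) by (intro exI[of _ q]) simp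
  show "K \<notin> earlier \<sigma>' ` {..<size_of \<sigma>'}" if "card K = s"
  proof
    assume "K \<in> earlier \<sigma>' ` {..<size_of \<sigma>'}"
    then obtain i where i: "K = earlier \<sigma>' i" "i < size_of \<sigma>'" by blast
    show False
    proof (cases "i < size_of \<sigma>")
      case True
      then show False using f'(3)[OF that] x(2)[of i] i by auto
    next
      case False
      then show False using x(5)[of i] i that K fits_less[OF v f] by auto
    qed
  qed
  fix u w assume uw: "u \<in> D" "(u, w) \<in> E" "w \<notin> D"
  have "w \<in> pverts G" using pair_graph_arcsD(2)[OF G uw(2)] .
  then show "w \<notin> rest \<sigma>'" "label \<sigma>' w \<in> K" "w \<in> V (label \<sigma>' w)"
    using f'(4)[OF uw] x(3)[of w] x(4) by auto
qed

text \<open>Solving one subproblem leaves the others fitting: their vertex sets are disjoint, and no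
  two of them share a full clique.\<close>

lemma solve_all:
  assumes "finite I" and "\<And>c. c \<in> I \<Longrightarrow> solvable (D c) (K c) (V c)"
    and "valid \<sigma>" and "\<And>c. c \<in> I \<Longrightarrow> fits \<sigma> (D c) (K c) (V c)"
    and "\<And>c c'. c \<in> I \<Longrightarrow> c' \<in> I \<Longrightarrow> c \<noteq> c' \<Longrightarrow> D c \<inter> D c' = {}"
    and "\<And>c c'. c \<in> I \<Longrightarrow> c' \<in> I \<Longrightarrow> c \<noteq> c' \<Longrightarrow> card (K c) = s \<Longrightarrow> K c \<noteq> K c'"
  shows "\<exists>\<sigma>'. valid \<sigma>' \<and> extends \<sigma> \<sigma>' (K ` I) (\<Union>c \<in> I. D c)"
  using assms
proof (induction I arbitrary: \<sigma> rule: finite_induct)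
  case empty
  then show ?case using extends_refl by auto
next
  case (insert c I)
  obtain \<sigma>1 where v1: "valid \<sigma>1" and x1: "extends \<sigma> \<sigma>1 {K c} (D c)"
    using insert.prems(1)[of c] insert.prems(2) insert.prems(3)[of c] unfolding solvable_def by blast
  have "\<exists>\<sigma>'. valid \<sigma>' \<and> extends \<sigma>1 \<sigma>' (K ` I) (\<Union>c \<in> I. D c)"
  proof (rule insert.IH)
    show "solvable (D c') (K c') (V c')" if "c' \<in> I" for c' using insert.prems(1) that by simp
    show "valid \<sigma>1" by fact
    show "fits \<sigma>1 (D c') (K c') (V c')" if c': "c' \<in> I" for c'
    proof (rule fits_extends[OF insert.prems(2) _ x1])
      have ne: "c' \<noteq> c" using c' insert.hyps by blast
      show "fits \<sigma> (D c') (K c') (V c')" using insert.prems(3) c' by simp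
      show "D c' \<inter> D c = {}" using insert.prems(4)[of c' c] c' ne by simp
      show "K c' \<notin> {K c}" if "card (K c') = s" using insert.prems(5)[of c' c] c' ne that by simp
    qed
  qed (use insert.prems(4,5) in auto)
  then obtain \<sigma>2 where "valid \<sigma>2" "extends \<sigma>1 \<sigma>2 (K ` I) (\<Union>c \<in> I. D c)" by blast
  then show ?case using extends_trans[OF x1] by fastforce
qed

lemma add_part:
  assumes v: "valid \<sigma>" and f: "fits \<sigma> D K V" and X: "X \<subseteq> D" and K: "finite K" "card K \<le> s"
    and Y: "Y \<subseteq> pverts T" "finite Y" "card Y \<le> t - 1" "X \<subseteq> \<Union>(W ` Y)"
    and n: "n = size_of \<sigma>"
  shows "\<exists>\<sigma>'. valid \<sigma>' \<and> extends \<sigma> \<sigma>' {K} X \<and> size_of \<sigma>' = Suc n \<and> earlier \<sigma>' n = K \<and>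
    (\<forall>u. label \<sigma>' u = (if u \<in> X then n else label \<sigma> u))"
proof -
  obtain q where q: "q < n" "K \<subseteq> insert q (earlier \<sigma> q)" using fitsD(2)[OF f] n by blast
  define \<sigma>' where "\<sigma>' = \<lparr>size_of = Suc n, parent = (parent \<sigma>)(n := q), earlier = (earlier \<sigma>)(n := K),
    label = (\<lambda>u. if u \<in> X then n else label \<sigma> u), rest = rest \<sigma> - X\<rparr>"
  note vD = validD[OF v, folded n]
  have Xr: "X \<subseteq> rest \<sigma>" using X fitsD(1)[OF f] by blast
  have old: "earlier \<sigma>' i = earlier \<sigma> i" "parent \<sigma>' i = parent \<sigma> i" if "i < n" for i
    using that by (simp_all add: \<sigma>'_def)
  have new: "earlier \<sigma>' n = K" "parent \<sigma>' n = q" "size_of \<sigma>' = Suc n" "rest \<sigma>' = rest \<sigma> - X"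
    and lab: "label \<sigma>' u = (if u \<in> X then n else label \<sigma> u)" for u by (simp_all add: \<sigma>'_def)
  have x: "extends \<sigma> \<sigma>' {K} X"
    unfolding extends_def n[symmetric] using old Xr new lab by (auto simp: less_Suc_eq)
  have "valid \<sigma>'"
    unfolding valid_def
  proof (intro conjI allI ballI impI)
    show "0 < size_of \<sigma>'" by (simp add: new)
    show "earlier \<sigma>' 0 = {}" using old(1)[of 0] vD(1,2) by simp
    show "parent \<sigma>' i < i" "earlier \<sigma>' i \<subseteq> insert (parent \<sigma>' i) (earlier \<sigma>' (parent \<sigma>' i))"
      if "i < size_of \<sigma>'" "0 < i" for i
    proof -
      have "parent \<sigma>' i < i \<and> earlier \<sigma>' i \<subseteq> insert (parent \<sigma>' i) (earlier \<sigma>' (parent \<sigma>' i))"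
      proof (cases "i < n")
        case True
        have "parent \<sigma> i < i" using vD(3) True that by blast
        then show ?thesis using True old[of i] old(1)[of "parent \<sigma> i"] vD(4)[of i] that by simp
      next
        case False
        then have "i = n" using that new(3) by simp
        then show ?thesis using q new old(1)[of q] by simp
      qed
      then show "parent \<sigma>' i < i" "earlier \<sigma>' i \<subseteq> insert (parent \<sigma>' i) (earlier \<sigma>' (parent \<sigma>' i))" by auto
    qed
    show "finite (earlier \<sigma>' i)" "card (earlier \<sigma>' i) \<le> s" if "i < size_of \<sigma>'" for i
      using that vD(5,6)[of i] K old(1)[of i] new by (auto simp: less_Suc_eq)
    show "inj_on (earlier \<sigma>') {i. i < size_of \<sigma>' \<and> card (earlier \<sigma>' i) = s}"
    proof (rule inj_onI)
      fix i j assume "i \<in> {i. i < size_of \<sigma>' \<and> card (earlier \<sigma>' i) = s}"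
        and "j \<in> {i. i < size_of \<sigma>' \<and> card (earlier \<sigma>' i) = s}" and eq: "earlier \<sigma>' i = earlier \<sigma>' j"
      then have ij: "i < Suc n" "j < Suc n" "card (earlier \<sigma>' i) = s" "card (earlier \<sigma>' j) = s"
        by (auto simp: new)
      have no: "earlier \<sigma>' k \<noteq> K" if "k < n" "card K = s" for k
        using fitsD(3)[OF f that(2)] old(1)[OF that(1)] that(1) n by auto
      consider "i < n" "j < n" | "i < n" "j = n" | "i = n" "j < n" | "i = n" "j = n"
        using ij by linarith
      then show "i = j"
      proof cases
        case 1
        then show ?thesis using inj_onD[OF vD(7), of i j] eq old(1) ij by simp
      next
        case 2
        then show ?thesis using no[of i] eq new ij by simp
      next
        case 3
        then show ?thesis using no[of j] eq new ij by simp
      qed simp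
    qed
    show "label \<sigma>' u < size_of \<sigma>'" if "u \<in> pverts G - rest \<sigma>'" for u
    proof (cases "u \<in> X")
      case False
      then have "label \<sigma> u < n" using vD(8)[of u] that new(4) by simp
      then show ?thesis using False lab new(3) by simp
    qed (simp add: lab new)
    show "\<exists>Y \<subseteq> pverts T. finite Y \<and> card Y \<le> t - 1 \<and>
      {u \<in> pverts G - rest \<sigma>'. label \<sigma>' u = i} \<subseteq> \<Union>(W ` Y)" if "i < size_of \<sigma>'" for i
    proof (cases "i = n")
      case True
      have "{u \<in> pverts G - rest \<sigma>'. label \<sigma>' u = i} \<subseteq> X"
      proof
        fix u assume u: "u \<in> {u \<in> pverts G - rest \<sigma>'. label \<sigma>' u = i}"
        show "u \<in> X"
        proof (rule ccontr)
          assume "u \<notin> X"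
          then have "label \<sigma> u < n" "label \<sigma> u = n" using vD(8)[of u] u new(4) lab True by auto
          then show False by simp
        qed
      qed
      then have "{u \<in> pverts G - rest \<sigma>'. label \<sigma>' u = i} \<subseteq> \<Union>(W ` Y)" using Y(4) by blast
      then show ?thesis using Y(1-3) by blast
    next
      case False
      then have "i < n" using that new(3) by simp
      then obtain Y' where Y': "Y' \<subseteq> pverts T" "finite Y'" "card Y' \<le> t - 1"
        "{u \<in> pverts G - rest \<sigma>. label \<sigma> u = i} \<subseteq> \<Union>(W ` Y')" using vD(9)[of i] by blast
      have "{u \<in> pverts G - rest \<sigma>'. label \<sigma>' u = i} \<subseteq> {u \<in> pverts G - rest \<sigma>. label \<sigma> u = i}"
        using False lab new(4) by (auto split: if_splits)
      then have "{u \<in> pverts G - rest \<sigma>'. label \<sigma>' u = i} \<subseteq> \<Union>(W ` Y')" using Y'(4) by (rule order_trans)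
      then show ?thesis using Y'(1-3) by blast
    qed
    fix u w assume uw: "(u, w) \<in> E" "u \<notin> rest \<sigma>'" "w \<notin> rest \<sigma>'"
    have VG: "u \<in> pverts G" "w \<in> pverts G" using pair_graph_arcsD[OF G uw(1)] by auto
    \<comment> \<open>All of \<open>D\<close> was unassigned, so an assigned \<open>b\<close>
      outside \<open>X\<close> is outside \<open>D\<close>, and \<open>fits\<close> applies to
      it.\<close>
    have half: "label \<sigma>' b \<in> K" if "a \<in> X" "b \<notin> X" "b \<notin> rest \<sigma>'" "(a, b) \<in> E" for a b
    proof -
      have "b \<notin> rest \<sigma>" "b \<notin> D" using that new(4) fitsD(1)[OF f] by auto
      then show ?thesis using fitsD(4)[OF f, of a b] that X lab by auto
    qed
    consider "u \<in> X" "w \<in> X" | "u \<in> X" "w \<notin> X" | "u \<notin> X" "w \<in> X" | "u \<notin> X" "w \<notin> X" by blast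
    then show "label \<sigma>' u = label \<sigma>' w \<or> label \<sigma>' u \<in> earlier \<sigma>' (label \<sigma>' w) \<or>
      label \<sigma>' w \<in> earlier \<sigma>' (label \<sigma>' u)"
    proof cases
      case 1 then show ?thesis by (simp add: lab)
    next
      case 2
      then have "label \<sigma>' w \<in> K" using half[of u w] uw by blast
      then show ?thesis using 2 by (simp add: lab new)
    next
      case 3
      then have "label \<sigma>' u \<in> K" using half[of w u] uw pair_graph_arcsD(4)[OF G uw(1)] by blast
      then show ?thesis using 3 by (simp add: lab new)
    next
      case 4
      then have r: "u \<notin> rest \<sigma>" "w \<notin> rest \<sigma>" using uw new(4) by auto
      then have "label \<sigma> u < n" "label \<sigma> w < n" using vD(8) VG by auto
      then show ?thesis using vD(10)[OF uw(1) r] 4 old(1) by (simp add: lab)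
    qed
  qed
  then show ?thesis using x new(1,3) lab by blast
qed

end

section \<open>Enlarging a branch set by the new part\<close>

text \<open>
  By minimality of the hitting set \<open>X\<close>, the vertex \<open>x\<close> lies on a linked set \<open>F\<close> avoiding the rest of
  \<open>X\<close>. So \<open>F\<close> leads from \<open>x\<close> to \<open>B\<close> inside one component of \<open>D - X\<close>, and that component is not in \<open>U\<close>.
\<close>

lemma reach_branch_set:
  assumes sE: "sym E" and F: "conn_on E F" "F \<subseteq> D" "F \<inter> X = {x}" and U: "U \<inter> X = {}" "U \<subseteq> D"
    and tch: "touches E F B" and B: "conn_on E B" "z \<in> B"
    and miss: "\<And>g. g \<in> U \<Longrightarrow> \<not> touches E (comp_of E (D - X) g) B"
  shows "x \<in> comp_of E (B \<union> (D - U)) z"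
proof -
  let ?M = "comp_of E (B \<union> (D - U)) z"
  have zB: "z \<in> B \<union> (D - U)" using B by blast
  have BM: "B \<subseteq> ?M" by (rule conn_on_subset_comp_of[OF B(1) _ B(2) comp_of_self zB]) blast
  have xD: "x \<in> D - U" "x \<in> F" "x \<in> X" using F U by blast+
  obtain f v where fv: "f \<in> F" "v \<in> B" "(f, v) \<in> E" "(v, f) \<in> E"
    using tch sE unfolding touches_def by (meson symD)
  show ?thesis
  proof (cases "f = x")
    case True
    then show ?thesis using comp_of_closed[of v E _ z f] zB fv BM xD by blast
  next
    case False
    \<comment> \<open>The way from \<open>x\<close> to \<open>B\<close>: the component of
      \<open>F - {x}\<close> at the neighbour \<open>f\<close> of \<open>B\<close>. It avoids
      \<open>X\<close> because \<open>F\<close> meets \<open>X\<close> only in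
      \<open>x\<close>.\<close>
    define C where "C = comp_of E (F - {x}) f"
    have f: "f \<in> F - {x}" using False fv by blast
    have CF: "C \<subseteq> F - {x}" unfolding C_def by (rule comp_of_subset[OF f])
    have connC: "conn_on E C" unfolding C_def by (rule conn_on_comp_of[OF sE f])
    have fC: "f \<in> C" by (simp add: C_def)
    have CDX: "C \<subseteq> D - X" using CF F by blast
    \<comment> \<open>If \<open>C\<close> had a vertex \<open>g\<close> in \<open>U\<close>, then
      \<open>C\<close> would lie in the component of \<open>g\<close> and touch \<open>B\<close> at
      \<open>f\<close>, against \<open>miss\<close>.\<close>
    have CU: "C \<inter> U = {}"
    proof (rule ccontr)
      assume "C \<inter> U \<noteq> {}"
      then obtain g where g: "g \<in> C" "g \<in> U" by blast
      then have "g \<in> D - X" using CDX by blast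
      then have "C \<subseteq> comp_of E (D - X) g"
        by (rule conn_on_subset_comp_of[OF connC CDX g(1) comp_of_self])
      then have "touches E (comp_of E (D - X) g) B" using fC fv unfolding touches_def by blast
      then show False using miss[OF g(2)] by blast
    qed
    then have C': "C \<subseteq> B \<union> (D - U)" using CDX by blast
    have fM: "f \<in> ?M" using comp_of_closed[of v E _ z f] zB fv BM C' fC by blast
    have CM: "C \<subseteq> ?M" by (rule conn_on_subset_comp_of[OF connC C' fC fM zB])
    \<comment> \<open>Without an arc to \<open>x\<close>, \<open>C\<close> would be closed in the
      connected set \<open>F\<close> and so contain \<open>x\<close>.\<close>
    have "\<exists>g \<in> C. (g, x) \<in> E"
    proof (rule ccontr)
      assume no: "\<not> ?thesis"
      have "C = F"
      proof (rule conn_onD[OF F(1) _ fC])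
        show "C \<subseteq> F" using CF by blast
        fix a b assume ab: "a \<in> C" "b \<in> F" "(a, b) \<in> E"
        then have "b \<noteq> x" using no by blast
        then show "b \<in> C" using comp_of_closed[of a E "F - {x}" f b] ab f unfolding C_def by blast
      qed
      then show False using CF xD by blast
    qed
    then show ?thesis using comp_of_closed[of _ E "B \<union> (D - U)" z x] zB CM xD(1) by blast
  qed
qed

text \<open>Every component is sent to a branch set that it misses, or to \<open>n\<close> if there is none.\<close>

definition missed ::
    "'a pair_pre_digraph \<Rightarrow> nat set \<Rightarrow> (nat \<Rightarrow> 'a set) \<Rightarrow> 'a set \<Rightarrow> nat \<Rightarrow> 'a \<Rightarrow> nat" where
  "missed G K V D n u =
    (if linked G K V (comp_of (parcs G) D u) then n
     else (LEAST j. j \<in> K \<and> \<not> touches (parcs G) (comp_of (parcs G) D u) (V j)))"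

lemma missed_cases:
  assumes "sym (parcs G)" "u \<in> D"
  shows "(missed G K V D n u = n \<and> linked G K V (comp_of (parcs G) D u)) \<or>
    (missed G K V D n u \<in> K \<and> \<not> linked G K V (comp_of (parcs G) D u) \<and>
      \<not> touches (parcs G) (comp_of (parcs G) D u) (V (missed G K V D n u)))"
proof (cases "linked G K V (comp_of (parcs G) D u)")
  case True
  then show ?thesis by (simp add: missed_def)
next
  case False
  moreover have "conn_on (parcs G) (comp_of (parcs G) D u)" "comp_of (parcs G) D u \<noteq> {}"
    using conn_on_comp_of[OF assms] comp_of_self[of u "parcs G" D] by blast+
  ultimately obtain j where "j \<in> K \<and> \<not> touches (parcs G) (comp_of (parcs G) D u) (V j)"
    unfolding linked_def by blast
  from LeastI[of "\<lambda>j. j \<in> K \<and> \<not> touches (parcs G) (comp_of (parcs G) D u) (V j)", OF this]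
  show ?thesis using False unfolding missed_def by simp
qed

text \<open>The classes of \<open>missed\<close> are unions of components, so an arc leaving a class
  also leaves \<open>D\<close>.\<close>

lemma missed_adjacent:
  assumes "sym (parcs G)" "u \<in> D" "w \<in> D" "(u, w) \<in> parcs G"
  shows "missed G K V D n w = missed G K V D n u"
proof -
  have "w \<in> comp_of (parcs G) D u" using comp_of_closed[OF comp_of_self assms(2-4)] .
  then have "comp_of (parcs G) D w = comp_of (parcs G) D u" by (rule comp_of_eq[OF assms(1)])
  then show ?thesis by (simp add: missed_def)
qed

section \<open>The recursion\<close>

context Kstar_free_decomposed begin

text \<open>As \<open>card K \<le> s\<close>, the measure compares \<open>card D\<close> first and
  \<open>card K\<close> second. If \<open>D\<close> contains a linked set, a new part is split off
  and \<open>D\<close> shrinks. Otherwise the components are grouped by a branch set that they miss,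
  and its index is dropped from \<open>K\<close>.\<close>

lemma solvable_model:
  assumes "clique_model G K V" "card K \<le> s" "D \<subseteq> pverts G" "\<And>i. i \<in> K \<Longrightarrow> V i \<inter> D = {}"
  shows "solvable D K V"
  using assms
proof (induction "card D * Suc s + card K" arbitrary: D K V rule: less_induct)
  case less
  note model = less.prems(1) and Ks = less.prems(2) and DG = less.prems(3) and VD = less.prems(4)
  have finD: "finite D" using finite_subset[OF DG pair_graph_finite[OF G]] .
  have finK: "finite K" using model by (simp add: clique_model_def)
  show ?case
    unfolding solvable_def
  proof (intro allI impI)
    fix \<sigma> assume v: "valid \<sigma>" and f: "fits \<sigma> D K V"
    define n where "n = size_of \<sigma>"
    have nK: "n \<notin> K" using fits_less[OF v f] by (auto simp: n_def)
    show "\<exists>\<sigma>'. valid \<sigma>' \<and> extends \<sigma> \<sigma>' {K} D"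
    proof (cases "\<exists>F \<subseteq> D. linked G K V F")
      case False
      define Dc where "Dc c = {u \<in> D. missed G K V D n u = c}" for c
      have mK: "missed G K V D n u \<in> K \<and> \<not> touches E (comp_of E D u) (V (missed G K V D n u))"
        if "u \<in> D" for u
        using missed_cases[OF sE that, of K V n] False comp_of_subset[OF that, of E] by blast
      have "\<exists>\<sigma>'. valid \<sigma>' \<and> extends \<sigma> \<sigma>' ((\<lambda>c. K - {c}) ` K) (\<Union>c \<in> K. Dc c)"
      proof (rule solve_all[OF finK _ v, of Dc "\<lambda>c. K - {c}" "\<lambda>_. V"])
        fix c assume c: "c \<in> K"
        have DcD: "Dc c \<subseteq> D" by (auto simp: Dc_def)
        have Kc: "card (K - {c}) < card K" using c finK by (meson card_Diff1_less)
        show "solvable (Dc c) (K - {c}) V"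
        proof (rule less.hyps)
          have "card (Dc c) \<le> card D" using DcD finD by (rule card_mono[rotated])
          then show "card (Dc c) * Suc s + card (K - {c}) < card D * Suc s + card K"
            using Kc by (meson add_le_less_mono mult_le_mono1)
          show "clique_model G (K - {c}) V" using model unfolding clique_model_def by simp
          show "card (K - {c}) \<le> s" using Kc Ks by simp
          show "Dc c \<subseteq> pverts G" using DcD DG by blast
          show "V i \<inter> Dc c = {}" if "i \<in> K - {c}" for i using VD[of i] that DcD by blast
        qed
        show "fits \<sigma> (Dc c) (K - {c}) V"
          unfolding fits_def
        proof (intro conjI ballI allI impI)
          show "Dc c \<subseteq> rest \<sigma>" using DcD fitsD(1)[OF f] by blast
          show "\<exists>q < size_of \<sigma>. K - {c} \<subseteq> insert q (earlier \<sigma> q)" using fitsD(2)[OF f] by blast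
          show "K - {c} \<notin> earlier \<sigma> ` {..<size_of \<sigma>}" if "card (K - {c}) = s"
            using that Kc Ks by simp
          fix u w assume uw: "u \<in> Dc c" "(u, w) \<in> E" "w \<notin> Dc c"
          have u: "u \<in> D" "missed G K V D n u = c" using uw(1) by (auto simp: Dc_def)
          have wD: "w \<notin> D" using missed_adjacent[OF sE u(1) _ uw(2), of K V n] u(2) uw(3) by (auto simp: Dc_def)
          note w = fitsD(4)[OF f u(1) uw(2) wD]
          have "label \<sigma> w \<noteq> c"
          proof
            assume "label \<sigma> w = c"
            then have "touches E (comp_of E D u) (V c)"
              using w uw(2) comp_of_self[of u E D] unfolding touches_def by blast
            then show False using mK[OF u(1)] u(2) by simp
          qed
          then show "w \<notin> rest \<sigma>" "label \<sigma> w \<in> K - {c}" "w \<in> V (label \<sigma> w)" using w by auto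
        qed
      next
        fix c c' assume "c \<in> K" "c' \<in> K" "c \<noteq> c'"
        then show "Dc c \<inter> Dc c' = {}" "K - {c} \<noteq> K - {c'}" by (auto simp: Dc_def)
      qed
      then obtain \<sigma>' where \<sigma>': "valid \<sigma>'" "extends \<sigma> \<sigma>' ((\<lambda>c. K - {c}) ` K) (\<Union>c \<in> K. Dc c)" by blast
      have "(\<Union>c \<in> K. Dc c) = D" using mK by (auto simp: Dc_def)
      \<comment> \<open>The sets \<open>K - {c}\<close> have fewer than \<open>s\<close> elements,
        so none of them uses up a full set.\<close>
      moreover have "extends \<sigma> \<sigma>' {K} (\<Union>c \<in> K. Dc c)"
      proof (rule extends_weaken[OF \<sigma>'(2)])
        fix L assume "L \<in> (\<lambda>c. K - {c}) ` K" "card L = s"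
        then obtain c where "c \<in> K" "card (K - {c}) = s" by blast
        moreover then have "card (K - {c}) < card K" using finK by (meson card_Diff1_less)
        ultimately have False using Ks by simp
        then show "L \<in> {K}" ..
      qed
      ultimately show ?thesis using \<sigma>'(1) by auto
    next
      case True
      then obtain F0 where F0: "F0 \<subseteq> D" "linked G K V F0" by blast
      obtain X Q Y where X: "X \<noteq> {}" "X \<subseteq> D" "Y \<subseteq> pverts T" "finite Y" "card Y \<le> t - 1"
          "X \<subseteq> \<Union>(W ` Y)" "\<forall>x \<in> X. \<exists>F \<subseteq> D. linked G K V F \<and> F \<inter> X = {x}"
        and XF: "\<forall>F \<subseteq> D - X. linked G K V F \<longrightarrow> card K < s \<and> F \<inter> Q = {}"
        and Q: "card K < s \<longrightarrow> X \<subseteq> Q \<and> Q \<subseteq> D \<and> linked G K V Q"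
        using new_part_exists[OF G td free t DG model _ Ks F0] VD by metis
      obtain \<sigma>1 where v1: "valid \<sigma>1" and x1: "extends \<sigma> \<sigma>1 {K} X"
        and \<sigma>1: "size_of \<sigma>1 = Suc n" "earlier \<sigma>1 n = K"
          "\<And>u. label \<sigma>1 u = (if u \<in> X then n else label \<sigma> u)"
        using add_part[OF v f X(2) finK Ks X(3-6) n_def] by blast
      have r1: "rest \<sigma>1 = rest \<sigma> - X" by (rule extendsD(4)[OF x1])
      define D' where "D' = D - X"
      define Dc where "Dc c = {u \<in> D'. missed G K V D' n u = c}" for c
      \<comment> \<open>The class \<open>n\<close> consists of the components still linked to all of
        \<open>K\<close>; by \<open>XF\<close> these occur only while \<open>K\<close> is not
        full.\<close>
      define I where "I = K \<union> (if card K < s then {n} else {})"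
      \<comment> \<open>For \<open>c\<close> in \<open>K\<close> the new part replaces
        \<open>c\<close>. For \<open>c = n\<close> nothing is removed, since \<open>n\<close> is not
        in \<open>K\<close>, and the clique grows.\<close>
      define Kc where "Kc c = insert n (K - {c})" for c
      define z where "z c = (SOME z. z \<in> V c)" for c
      \<comment> \<open>The new index gets the branch set \<open>Q\<close> in the class
        \<open>n\<close>; otherwise it gets \<open>V c\<close> enlarged by all that is reachable
        from it in \<open>D\<close> without entering \<open>Dc c\<close>.\<close>
      define Vc where "Vc c = V(n := if c = n then Q else comp_of E (V c \<union> (D - Dc c)) (z c))" for c
      have DcD: "Dc c \<subseteq> D - X" for c by (auto simp: Dc_def D'_def)
      have z: "z c \<in> V c" if "c \<in> K" for c
        using model that someI_ex[of "\<lambda>z. z \<in> V c"] unfolding clique_model_def z_def by blast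
      have miss: "\<not> touches E (comp_of E (D - X) u) (V c)" if "c \<in> K" "u \<in> Dc c" for c u
        using missed_cases[OF sE, of u D' K V n] that nK unfolding Dc_def D'_def by auto
      have connV: "conn_on E (V c)" if "c \<in> K" for c using model that by (simp add: clique_model_def)
      \<comment> \<open>This lets \<open>fits\<close> hold again: neighbours in \<open>X\<close>
        have the label \<open>n\<close> and must lie in the branch set of \<open>n\<close>.\<close>
      have XM: "X \<subseteq> Vc c n" if c: "c \<in> I" for c
      proof (cases "c = n")
        case True
        then have "card K < s" using c nK by (auto simp: I_def split: if_splits)
        then show ?thesis using Q True by (simp add: Vc_def)
      next
        case False
        then have cK: "c \<in> K" using c by (auto simp: I_def split: if_splits)
        show ?thesis
        proof
          fix x assume "x \<in> X"
          then obtain F where F: "F \<subseteq> D" "linked G K V F" "F \<inter> X = {x}" using X(7) by blast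
          have "x \<in> comp_of E (V c \<union> (D - Dc c)) (z c)"
          proof (rule reach_branch_set[OF sE _ F(1,3)])
            show "conn_on E F" "touches E F (V c)" using F(2) cK by (simp_all add: linked_def)
            show "Dc c \<inter> X = {}" "Dc c \<subseteq> D" using DcD[of c] by blast+
          qed (use connV[OF cK] z[OF cK] miss[OF cK] in auto)
          then show "x \<in> Vc c n" using False by (simp add: Vc_def)
        qed
      qed
      have zU: "z c \<in> V c \<union> (D - Dc c)" if "c \<in> K" for c using z[OF that] by blast
      have VM: "V c \<subseteq> Vc c n" "Vc c n \<subseteq> V c \<union> (D - Dc c)" "conn_on E (Vc c n)" if c: "c \<in> K" for c
      proof -
        have e: "Vc c n = comp_of E (V c \<union> (D - Dc c)) (z c)" using c nK by (auto simp: Vc_def)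
        show "V c \<subseteq> Vc c n" unfolding e
          by (rule conn_on_subset_comp_of[OF connV[OF c] _ z[OF c] comp_of_self zU[OF c]]) blast
        show "Vc c n \<subseteq> V c \<union> (D - Dc c)" unfolding e by (rule comp_of_subset[OF zU[OF c]])
        show "conn_on E (Vc c n)" unfolding e by (rule conn_on_comp_of[OF sE zU[OF c]])
      qed
      have Vold: "Vc c i = V i" if "i \<in> K" for c i using that nK by (auto simp: Vc_def)
      have nI: "card K < s" if "n \<in> I" using that nK by (auto simp: I_def split: if_splits)
      have cI: "c \<in> K \<or> c = n" if "c \<in> I" for c using that by (auto simp: I_def split: if_splits)
      have new_set: "Vc c n \<subseteq> pverts G \<and> Vc c n \<noteq> {} \<and> conn_on E (Vc c n) \<and> Vc c n \<inter> Dc c = {} \<and>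
          (\<forall>i \<in> K - {c}. Vc c n \<inter> V i = {} \<and> touches E (Vc c n) (V i))" if c: "c \<in> I" for c
      proof (cases "c = n")
        case True
        have Q': "X \<subseteq> Q" "Q \<subseteq> D" "linked G K V Q" using Q nI c True by auto
        have e: "Vc c n = Q" using True by (simp add: Vc_def)
        \<comment> \<open>A component in the class \<open>n\<close> is a linked subset of
          \<open>D - X\<close>, so \<open>XF\<close> separates it from \<open>Q\<close>.\<close>
        have "Q \<inter> Dc c = {}"
        proof (rule ccontr)
          assume "Q \<inter> Dc c \<noteq> {}"
          then obtain u where u: "u \<in> Q" "u \<in> D'" "missed G K V D' n u = n"
            unfolding Dc_def True by blast
          then have "linked G K V (comp_of E D' u)" using missed_cases[OF sE u(2), of K V n] nK by metis
          moreover have "comp_of E D' u \<subseteq> D - X" using comp_of_subset[OF u(2), of E] by (simp add: D'_def)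
          ultimately have "comp_of E D' u \<inter> Q = {}" using XF by blast
          then show False using u(1) comp_of_self[of u E D'] by blast
        qed
        moreover have "Q \<inter> V i = {}" if "i \<in> K" for i using VD[OF that] Q'(2) by blast
        ultimately show ?thesis unfolding e using Q'(2,3) DG unfolding linked_def by auto
      next
        case False
        then have cK: "c \<in> K" using cI[OF c] by blast
        have Vc: "V c \<subseteq> pverts G" "V c \<noteq> {}" using model cK by (auto simp: clique_model_def)
        note M = VM[OF cK]
        \<comment> \<open>The enlarged set inherits adjacency from \<open>V c\<close>; it grows only
          inside \<open>D\<close>, which the other branch sets avoid.\<close>
        have "Vc c n \<inter> V i = {} \<and> touches E (Vc c n) (V i)" if "i \<in> K - {c}" for i
        proof -
          have i: "i \<in> K" "c \<noteq> i" using that by auto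
          then have "V c \<inter> V i = {}" "touches E (V c) (V i)"
            using model cK by (simp_all add: clique_model_def)
          then show ?thesis using VD[OF i(1)] M(1,2) touches_mono[of E "V c" "V i" "Vc c n" "V i"] by blast
        qed
        moreover have "Vc c n \<subseteq> pverts G" using M(2) Vc(1) DG by blast
        moreover have "Vc c n \<inter> Dc c = {}" using M(2) VD[OF cK] DcD[of c] by blast
        moreover have "Vc c n \<noteq> {}" using M(1) Vc(2) by blast
        ultimately show ?thesis using M(3) by blast
      qed
      have "\<exists>\<sigma>'. valid \<sigma>' \<and> extends \<sigma>1 \<sigma>' (Kc ` I) (\<Union>c \<in> I. Dc c)"
      proof (rule solve_all[of I Dc Kc Vc, OF _ _ v1])
        show "finite I" using finK by (simp add: I_def)
        fix c assume c: "c \<in> I"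
        show "solvable (Dc c) (Kc c) (Vc c)"
        proof (rule less.hyps)
          have "Dc c \<subset> D" using DcD[of c] X(1,2) by blast
          then have "card (Dc c) < card D" using finD by (rule psubset_card_mono[rotated])
          \<comment> \<open>Losing one vertex of \<open>D\<close> outweighs any growth of the
            clique, whose size stays at most \<open>s\<close>.\<close>
          then have "card (Dc c) * Suc s + Suc s \<le> card D * Suc s"
            by (metis Suc_leI add.commute mult_Suc mult_le_mono1)
          moreover show cK: "card (Kc c) \<le> s"
          proof (cases "c = n")
            case True
            then show ?thesis using nI c nK finK by (simp add: Kc_def)
          next
            case False
            then have "c \<in> K" using cI[OF c] by blast
            then have "card (Kc c) = card K"
              using nK finK card.remove[of K c] by (simp add: Kc_def)
            then show ?thesis using Ks by simp
          qed
          ultimately show "card (Dc c) * Suc s + card (Kc c) < card D * Suc s + card K" by simp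
          show "clique_model G (Kc c) (Vc c)"
            unfolding clique_model_def
          proof (intro conjI ballI impI)
            show "finite (Kc c)" using finK by (simp add: Kc_def)
            fix i assume i: "i \<in> Kc c"
            have "Vc c i \<subseteq> pverts G \<and> Vc c i \<noteq> {} \<and> conn_on E (Vc c i)"
            proof (cases "i = n")
              case False
              then have "i \<in> K" using i by (simp add: Kc_def)
              then show ?thesis using model Vold[of i c] by (simp add: clique_model_def)
            qed (use new_set[OF c] in simp)
            then show "Vc c i \<subseteq> pverts G" "Vc c i \<noteq> {}" "conn_on E (Vc c i)" by auto
            fix j assume j: "j \<in> Kc c" and ij: "i \<noteq> j"
            have K1: "k \<in> K - {c}" if "k \<in> Kc c" "k \<noteq> n" for k using that by (simp add: Kc_def)
            have "Vc c i \<inter> Vc c j = {} \<and> touches E (Vc c i) (Vc c j)"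
            proof -
              consider "i = n" "j \<noteq> n" | "i \<noteq> n" "j = n" | "i \<noteq> n" "j \<noteq> n" using ij by blast
              then show ?thesis
              proof cases
                case 1
                then show ?thesis using new_set[OF c] K1[OF j] Vold[of j c] by simp
              next
                case 2
                then have "Vc c n \<inter> V i = {} \<and> touches E (Vc c n) (V i)" "i \<in> K"
                  using new_set[OF c] K1[OF i] by blast+
                then show ?thesis using touches_sym[OF sE] Vold[of i c] 2 by (simp add: Int_commute)
              next
                case 3
                then have "i \<in> K" "j \<in> K" using K1 i j by blast+
                then show ?thesis using model ij Vold[of i c] Vold[of j c] by (simp add: clique_model_def)
              qed
            qed
            then show "Vc c i \<inter> Vc c j = {}" "touches E (Vc c i) (Vc c j)" by auto
          qed
          show "Dc c \<subseteq> pverts G" using DcD[of c] DG by blast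
          show "Vc c i \<inter> Dc c = {}" if "i \<in> Kc c" for i
          proof (cases "i = n")
            case False
            then have "i \<in> K" using that by (simp add: Kc_def)
            then show ?thesis using VD[of i] Vold[of i c] DcD[of c] by auto
          qed (use new_set[OF c] in simp)
        qed
        show "fits \<sigma>1 (Dc c) (Kc c) (Vc c)"
          unfolding fits_def
        proof (intro conjI ballI allI impI)
          show "Dc c \<subseteq> rest \<sigma>1" using DcD[of c] fitsD(1)[OF f] r1 by blast
          show "\<exists>q < size_of \<sigma>1. Kc c \<subseteq> insert q (earlier \<sigma>1 q)"
            using \<sigma>1 by (intro exI[of _ n]) (auto simp: Kc_def)
          \<comment> \<open>\<open>Kc c\<close> contains \<open>n\<close>, while the
            \<open>earlier\<close> sets of nodes up to \<open>n\<close> contain only numbers below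
            \<open>n\<close>.\<close>
          show "Kc c \<notin> earlier \<sigma>1 ` {..<size_of \<sigma>1}"
          proof
            assume "Kc c \<in> earlier \<sigma>1 ` {..<size_of \<sigma>1}"
            then obtain i where i: "i < Suc n" "Kc c = earlier \<sigma>1 i" using \<sigma>1(1) by auto
            then have "n \<in> {..<i}" using earlier_less[OF v1, of i] \<sigma>1(1) by (auto simp: Kc_def)
            then show False using i by simp
          qed
          fix u w assume uw: "u \<in> Dc c" "(u, w) \<in> E" "w \<notin> Dc c"
          have u: "u \<in> D'" "missed G K V D' n u = c" "u \<in> D" using uw(1) by (auto simp: Dc_def D'_def)
          have wD': "w \<notin> D'" using missed_adjacent[OF sE u(1) _ uw(2), of K V n] u(2) uw(3) by (auto simp: Dc_def)
          have "w \<notin> rest \<sigma>1 \<and> label \<sigma>1 w \<in> Kc c \<and> w \<in> Vc c (label \<sigma>1 w)"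
          proof (cases "w \<in> D")
            case True
            then have "w \<in> X" using wD' by (simp add: D'_def)
            then show ?thesis using XM[OF c] r1 \<sigma>1(3)[of w] by (auto simp: Kc_def)
          next
            case False
            note w = fitsD(4)[OF f u(3) uw(2) False]
            have wX: "w \<notin> X" using False X(2) by blast
            have "label \<sigma> w \<noteq> c"
            proof
              assume l: "label \<sigma> w = c"
              then have "touches E (comp_of E (D - X) u) (V c)"
                using w uw(2) comp_of_self[of u E "D - X"] unfolding touches_def by blast
              then show False using miss[of c u] uw(1) w l by blast
            qed
            then show ?thesis using w wX r1 \<sigma>1(3)[of w] Vold[of "label \<sigma> w" c] by (simp add: Kc_def)
          qed
          then show "w \<notin> rest \<sigma>1" "label \<sigma>1 w \<in> Kc c" "w \<in> Vc c (label \<sigma>1 w)" by auto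
        qed
      next
        fix c c' assume c: "c \<in> I" "c' \<in> I" "c \<noteq> c'"
        show "Dc c \<inter> Dc c' = {}" using c(3) by (auto simp: Dc_def)
        \<comment> \<open>Distinct classes need distinct cliques, as a full set can be used only
          once. Equal cliques would put both \<open>c\<close> and \<open>c'\<close> into their own
          \<open>Kc\<close>, forcing both to be \<open>n\<close>.\<close>
        have "c \<in> Kc c \<longleftrightarrow> c = n" "c' \<in> Kc c' \<longleftrightarrow> c' = n" "c \<in> Kc c'" "c' \<in> Kc c"
          using cI[OF c(1)] cI[OF c(2)] c(3) by (auto simp: Kc_def)
        then show "Kc c \<noteq> Kc c'" using c(3) by metis
      qed
      then obtain \<sigma>' where \<sigma>': "valid \<sigma>'" "extends \<sigma>1 \<sigma>' (Kc ` I) (\<Union>c \<in> I. Dc c)" by blast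
      have "(\<Union>c \<in> I. Dc c) = D - X"
      proof
        show "(\<Union>c \<in> I. Dc c) \<subseteq> D - X" using DcD by blast
        show "D - X \<subseteq> (\<Union>c \<in> I. Dc c)"
        proof
          fix u assume u: "u \<in> D - X"
          have "missed G K V D' n u \<in> I"
          proof -
            have "card K < s" if "linked G K V (comp_of E D' u)"
              using XF that comp_of_subset[of u D' E] u unfolding D'_def by blast
            then show ?thesis using missed_cases[OF sE, of u D' K V n] u unfolding I_def D'_def by auto
          qed
          then show "u \<in> (\<Union>c \<in> I. Dc c)" using u by (auto simp: Dc_def D'_def)
        qed
      qed
      then have "X \<union> (\<Union>c \<in> I. Dc c) = D" using X(2) by blast
      \<comment> \<open>All sets \<open>Kc c\<close> contain the new number \<open>n\<close>, so
        from the viewpoint of \<open>\<sigma>\<close> only \<open>K\<close> is used up.\<close>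
      moreover have "extends \<sigma> \<sigma>' {K} (X \<union> (\<Union>c \<in> I. Dc c))"
      proof (rule extends_weaken[OF extends_trans[OF x1 \<sigma>'(2)]])
        fix L assume L: "L \<in> {K} \<union> Kc ` I" "L \<subseteq> {..<size_of \<sigma>}"
        then have "n \<notin> L" by (auto simp: n_def)
        then show "L \<in> {K}" using L(1) by (auto simp: Kc_def)
      qed
      ultimately show ?thesis using \<sigma>'(1) by auto
    qed
  qed
qed

lemma partition_exists:
  assumes "0 < s"
  shows "\<exists>\<sigma>. valid \<sigma> \<and> rest \<sigma> = {}"
proof -
  \<comment> \<open>The start is one empty part \<open>0\<close> as root, with every vertex
    unassigned. The clique \<open>{}\<close> then fits because \<open>0 < s\<close> keeps it from
    being full.\<close>
  define \<sigma> :: "'a partial_partition" where "\<sigma> = \<lparr>size_of = 1, parent = (\<lambda>_. 0), earlier = (\<lambda>_. {}),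
    label = (\<lambda>_. 0), rest = pverts G\<rparr>"
  have v: "valid \<sigma>"
    unfolding valid_def \<sigma>_def using pair_graph_arcsD(1)[OF G] assms by auto
  have f: "fits \<sigma> (pverts G) {} (\<lambda>_. {})"
    unfolding fits_def \<sigma>_def using pair_graph_arcsD(2)[OF G] assms by auto
  have "solvable (pverts G) {} (\<lambda>_. {})"
    by (rule solvable_model) (simp_all add: clique_model_def)
  then obtain \<sigma>' where "valid \<sigma>'" "extends \<sigma> \<sigma>' {{}} (pverts G)"
    using v f unfolding solvable_def by blast
  moreover then have "rest \<sigma>' = {}" using extendsD(4)[of \<sigma> \<sigma>'] by (simp add: \<sigma>_def)
  ultimately show ?thesis by blast
qed

end

section \<open>Tree-decomposition of the quotient\<close>

definition parent_tree :: "nat \<Rightarrow> (nat \<Rightarrow> nat) \<Rightarrow> nat pair_pre_digraph" where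
  "parent_tree n p = \<lparr>pverts = {..<n},
    parcs = {(i, j). i < n \<and> j < n \<and> (0 < i \<and> j = p i \<or> 0 < j \<and> i = p j)}\<rparr>"

lemma pair_graph_parent_tree:
  assumes "\<And>i. 0 < i \<Longrightarrow> i < n \<Longrightarrow> p i < i"
  shows "pair_graph (parent_tree n p)"
proof (rule pair_graphI)
  show "x \<noteq> y" if "(x, y) \<in> parcs (parent_tree n p)" for x y
    using that assms[of x] assms[of y] by (auto simp: parent_tree_def)
qed (auto simp: parent_tree_def sym_def)

text \<open>Climbing from any vertex of \<open>M\<close> stays in \<open>M\<close> and ends at
  \<open>v\<close>. So a nonempty closed subset contains \<open>v\<close>, and by ascending
  induction all of \<open>M\<close>.\<close>

lemma conn_on_parent_tree:
  assumes p: "\<And>i. 0 < i \<Longrightarrow> i < n \<Longrightarrow> p i < i" and M: "M \<subseteq> {..<n}" "v \<in> M"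
    and cl: "\<And>i. i \<in> M \<Longrightarrow> i \<noteq> v \<Longrightarrow> 0 < i \<and> p i \<in> M"
  shows "conn_on (parcs (parent_tree n p)) M"
proof (rule conn_onI)
  fix Z z assume Z: "Z \<subseteq> M" "z \<in> Z"
    and zcl: "\<And>x y. x \<in> Z \<Longrightarrow> y \<in> M \<Longrightarrow> (x, y) \<in> parcs (parent_tree n p) \<Longrightarrow> y \<in> Z"
  have edge: "(i, p i) \<in> parcs (parent_tree n p) \<and> (p i, i) \<in> parcs (parent_tree n p)"
    if "i \<in> M" "i \<noteq> v" for i
    using cl[OF that] that M(1) p[of i] by (auto simp: parent_tree_def)
  have "v \<in> Z" using Z(2)
  proof (induction z rule: less_induct)
    case (less i)
    show ?case
    proof (cases "i = v")
      case False
      have i: "i \<in> M" using less.prems Z(1) by blast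
      then have "p i \<in> Z" using zcl[OF less.prems] edge[OF i False] cl[OF i False] by blast
      moreover have "p i < i" using p[of i] cl[OF i False] i M(1) by blast
      ultimately show ?thesis using less.IH by blast
    qed (use less.prems in simp)
  qed
  have "i \<in> M \<Longrightarrow> i \<in> Z" for i
  proof (induction i rule: less_induct)
    case (less i)
    show ?case
    proof (cases "i = v")
      case False
      have "p i < i" "p i \<in> M" using p[of i] cl[OF less.prems False] less.prems M(1) by blast+
      then have "p i \<in> Z" using less.IH by blast
      then show ?thesis using zcl edge[OF less.prems False] less.prems by blast
    qed (use \<open>v \<in> Z\<close> in simp)
  qed
  then show "M \<subseteq> Z" by blast
qed

lemma cycle_nth:
  assumes "pcas u es v" "i < length es"
  shows "fst (es ! i) = (if i = 0 then u else snd (es ! (i - 1)))"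
    and "es \<noteq> [] \<Longrightarrow> snd (last es) = v"
proof -
  show "fst (es ! i) = (if i = 0 then u else snd (es ! (i - 1)))"
    using assms by (induction es arbitrary: u i) (auto simp: nth_Cons split: nat.splits)
  show "es \<noteq> [] \<Longrightarrow> snd (last es) = v" using assms(1) by (induction es arbitrary: u) auto
qed

text \<open>The largest vertex on a cycle has two smaller cyclic neighbours, and both must be its
  parent. On a cycle of length at least three they are distinct.\<close>

lemma undirected_tree_parent_tree:
  assumes n: "0 < n" and p: "\<And>i. 0 < i \<Longrightarrow> i < n \<Longrightarrow> p i < i"
  shows "undirected_tree (parent_tree n p)"
  unfolding undirected_tree_def
proof (intro conjI notI)
  let ?T = "parent_tree n p"
  show pg: "pair_graph ?T" by (rule pair_graph_parent_tree[OF p])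
  have "conn_on (parcs ?T) {..<n}"
    by (rule conn_on_parent_tree[of n p _ 0]) (use n p in \<open>auto intro: less_trans\<close>)
  then show "connected (with_proj ?T)"
    using connected_iff[OF pg] n by (auto simp: parent_tree_def)
  assume "\<exists>es. pre_digraph.cycle (with_proj ?T) es \<and> 3 \<le> length es"
  then obtain es where es: "pre_digraph.cycle (with_proj ?T) es" "3 \<le> length es" by blast
  interpret T: pair_graph ?T by (rule pg)
  obtain u where u: "set es \<subseteq> parcs ?T" "pcas u es u" "distinct (tl (pawalk_verts u es))"
    using es(1) unfolding T.cycle_def T.awalk_def by blast
  define l where "l = length es"
  define h where "h i = snd (es ! i)" for i
  have ne: "es \<noteq> []" and l: "3 \<le> l" using es(2) by (auto simp: l_def)
  have "tl (pawalk_verts u es) = map snd es"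
    using T.awalk_verts_conv'[OF u(2)] ne by simp
  then have "distinct (map snd es)" using u(3) by simp
  then have inj: "i = j" if "h i = h j" "i < l" "j < l" for i j
    using that nth_eq_iff_index_eq[of "map snd es" i j] by (simp add: h_def l_def)
  \<comment> \<open>Indices are cyclic: arc \<open>0\<close> starts where the last arc ends.\<close>
  have step: "(h (if i = 0 then l - 1 else i - 1), h i) \<in> parcs ?T" if "i < l" for i
  proof -
    have "es ! i \<in> parcs ?T" using u(1) that by (auto simp: l_def)
    moreover have "fst (es ! i) = h (if i = 0 then l - 1 else i - 1)"
      using cycle_nth[OF u(2), of i] that ne by (simp add: h_def l_def last_conv_nth)
    ultimately show ?thesis by (metis h_def prod.collapse)
  qed
  have "Max (h ` {..<l}) \<in> h ` {..<l}" using l by (intro Max_in) (auto simp: lessThan_empty_iff)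
  then obtain k where k: "k < l" "h k = Max (h ` {..<l})" by auto
  have max: "h i \<le> h k" if "i < l" for i using that k(2) by simp
  have nb: "j = p (h k)" if "(j, h k) \<in> parcs ?T \<or> (h k, j) \<in> parcs ?T" "j \<le> h k" for j
    using that p[of j] pair_graph_arcsD(3)[OF pg, of j "h k"] pair_graph_arcsD(3)[OF pg, of "h k" j]
    by (auto simp: parent_tree_def)
  define a where "a = (if k = 0 then l - 1 else k - 1)"
  define b where "b = (if k = l - 1 then 0 else k + 1)"
  have ab: "a < l" "b < l" "a \<noteq> b" using k(1) l by (auto simp: a_def b_def)
  have "(h a, h k) \<in> parcs ?T" using step[OF k(1)] by (simp add: a_def)
  then have 1: "h a = p (h k)" using nb max[OF ab(1)] by blast
  have "(h k, h b) \<in> parcs ?T" using step[OF ab(2)] k(1) by (auto simp: b_def split: if_splits)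
  then have "h b = p (h k)" using nb max[OF ab(2)] by blast
  then show False using inj[of a b] ab 1 by simp
qed

text \<open>The bags are \<open>insert i (K i)\<close>. Let \<open>S\<close> have size
  \<open>s\<close> and maximum \<open>m\<close>. If another bag, at \<open>x\<close>, contains
  \<open>S\<close>, then \<open>m\<close> is in \<open>K x\<close>, so \<open>x\<close> exceeds all
  of \<open>S\<close> and \<open>K x = S\<close> by size. Injectivity leaves at most one such
  \<open>x\<close> besides \<open>m\<close>.\<close>

lemma simple_treewidth_le:
  fixes K :: "nat \<Rightarrow> nat set"
  assumes n: "0 < n" and K0: "K 0 = {}"
    and p: "\<And>i. i < n \<Longrightarrow> 0 < i \<Longrightarrow> p i < i \<and> K i \<subseteq> insert (p i) (K (p i))"
    and less: "\<And>i. i < n \<Longrightarrow> K i \<subseteq> {..<i}" and card: "\<And>i. i < n \<Longrightarrow> card (K i) \<le> s"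
    and inj: "inj_on K {i. i < n \<and> card (K i) = s}" and s: "0 < s"
  defines "H \<equiv> \<lparr>pverts = {..<n}, parcs = {(i, j). i < n \<and> j < n \<and> (i \<in> K j \<or> j \<in> K i)}\<rparr>"
  shows "pair_graph H \<and> simple_treewidth H \<le> s"
proof (intro conjI)
  let ?B = "\<lambda>i. insert i (K i)"
  let ?T = "parent_tree n p"
  have finK: "finite (K i)" if "i < n" for i using less[OF that] finite_subset by blast
  show "pair_graph H"
  proof (rule pair_graphI)
    show "x \<noteq> y" if "(x, y) \<in> parcs H" for x y
      using that less[of x] less[of y] by (auto simp: H_def)
  qed (auto simp: H_def sym_def)
  have p': "\<And>i. 0 < i \<Longrightarrow> i < n \<Longrightarrow> p i < i" using p by blast
  have "connected (with_proj ?T \<restriction> {x \<in> pverts ?T. v \<in> ?B x})" if v: "v < n" for v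
  proof -
    have "conn_on (parcs ?T) {x \<in> pverts ?T. v \<in> ?B x}"
    proof (rule conn_on_parent_tree[OF p'])
      show "v \<in> {x \<in> pverts ?T. v \<in> ?B x}" using v by (simp add: parent_tree_def)
      fix i assume i: "i \<in> {x \<in> pverts ?T. v \<in> ?B x}" "i \<noteq> v"
      then have i': "i < n" "v \<in> K i" by (auto simp: parent_tree_def)
      then have i0: "0 < i" using K0 by (cases i) auto
      then show "0 < i \<and> p i \<in> {x \<in> pverts ?T. v \<in> ?B x}"
        using p[OF i'(1) i0] i' by (auto simp: parent_tree_def)
    qed (auto simp: parent_tree_def)
    moreover have "v \<in> {x \<in> pverts ?T. v \<in> ?B x}" using v by (simp add: parent_tree_def)
    ultimately show ?thesis
      using connected_induce_iff[OF pair_graph_sym[OF pair_graph_parent_tree[OF p']]] by blast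
  qed
  moreover have "?B x \<subseteq> pverts H" if "x \<in> pverts ?T" for x
    using that less[of x] by (force simp: parent_tree_def H_def)
  ultimately have "tree_decomposition H ?T ?B"
    unfolding tree_decomposition_def using undirected_tree_parent_tree[OF n p']
    by (auto simp: H_def parent_tree_def)
  moreover have "k_simple s H ?T ?B"
    unfolding k_simple_def
  proof (intro conjI ballI allI impI)
    show "card (?B x) \<le> s + 1" if "x \<in> pverts ?T" for x
      using that card[of x] finK[of x] by (simp add: parent_tree_def card_insert_if)
    fix S assume S: "S \<subseteq> pverts H \<and> card S = s"
    \<comment> \<open>Since \<open>0 < s\<close>, having cardinality \<open>s\<close> excludes both
      infinite sets and the empty set.\<close>
    then have finS: "finite S" and Sne: "S \<noteq> {}" using s by (auto intro: card_ge_0_finite)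
    define m where "m = Max S"
    have mS: "m \<in> S" unfolding m_def using finS Sne by simp
    have eq: "K x = S" if x: "x < n" "S \<subseteq> ?B x" "x \<noteq> m" for x
    proof -
      have "m \<in> K x" using x mS by blast
      then have "m < x" using less[OF x(1)] by blast
      then have "x \<notin> S" using Max_ge[OF finS, of x] by (auto simp: m_def)
      then have "S \<subseteq> K x" using x(2) by blast
      then show ?thesis using card[OF x(1)] S finK[OF x(1)] card_seteq by metis
    qed
    have "x = y" if "x < n" "y < n" "K x = S" "K y = S" for x y
      using inj_onD[OF inj, of x y] S that by simp
    then have "card {x. x < n \<and> K x = S} \<le> Suc 0"
      by (subst card_le_Suc0_iff_eq) auto
    moreover have "{x \<in> pverts ?T. S \<subseteq> ?B x} \<subseteq> insert m {x. x < n \<and> K x = S}"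
      using eq by (auto simp: parent_tree_def)
    then have "card {x \<in> pverts ?T. S \<subseteq> ?B x} \<le> card (insert m {x. x < n \<and> K x = S})"
      by (intro card_mono) auto
    moreover have "card (insert m {x. x < n \<and> K x = S}) \<le> Suc (card {x. x < n \<and> K x = S})"
      by (simp add: card_insert_if)
    ultimately show "card {x \<in> pverts ?T. S \<subseteq> ?B x} \<le> 2" by linarith
  qed
  ultimately show "simple_treewidth H \<le> s"
    unfolding simple_treewidth_def by (intro Least_le exI conjI)
qed

section \<open>Product structure\<close>

text \<open>The minimum is attained once any bound is feasible; a single layer and a single bag,
  both all of \<open>pverts G\<close>, provide one.\<close>

lemma layered_treewidth_witness:
  assumes G: "pair_graph G"
  obtains L and T :: "nat pair_pre_digraph" and W where "layering G L" "tree_decomposition G T W"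
    "\<And>i x. x \<in> pverts T \<Longrightarrow> card (L i \<inter> W x) \<le> layered_treewidth G"
proof -
  let ?P = "\<lambda>k. \<exists>L (T :: nat pair_pre_digraph) W. layering G L \<and> tree_decomposition G T W \<and>
    (\<forall>i. \<forall>x \<in> pverts T. card (L i \<inter> W x) \<le> k)"
  let ?L = "\<lambda>i::nat. if i = 0 then pverts G else {}"
  let ?T = "parent_tree (Suc 0) id" and ?W = "\<lambda>_::nat. pverts G"
  have T: "parent_tree (Suc 0) id = \<lparr>pverts = {0}, parcs = {}\<rparr>" by (auto simp: parent_tree_def)
  have pg: "pair_graph ?T" by (rule pair_graph_parent_tree) simp
  have "layering G ?L" unfolding layering_def by auto
  moreover have "tree_decomposition G ?T ?W"
  proof -
    have "connected (with_proj ?T \<restriction> {x \<in> pverts ?T. v \<in> ?W x})" if "v \<in> pverts G" for v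
    proof -
      have "{x \<in> pverts ?T. v \<in> ?W x} = {0}" using that by (simp add: T)
      then show ?thesis
        using connected_induce_iff[OF pair_graph_sym[OF pg], of "{0}"]
          conn_on_singleton[of "parcs ?T" 0] by simp
    qed
    moreover have "undirected_tree ?T" by (rule undirected_tree_parent_tree) auto
    moreover have "(v, w) \<in> parcs G \<Longrightarrow> v \<in> pverts G \<and> w \<in> pverts G" for v w
      using pair_graph_arcsD[OF G] by blast
    ultimately show ?thesis unfolding tree_decomposition_def by (auto simp: T)
  qed
  moreover have "\<forall>i. \<forall>x \<in> pverts ?T. card (?L i \<inter> ?W x) \<le> card (pverts G)" by simp
  ultimately have "?P (card (pverts G))" by blast
  then have "?P (layered_treewidth G)" unfolding layered_treewidth_def by (rule LeastI)
  then show thesis using that by blast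
qed

lemma strong_product_arcI:
  assumes "v \<in> pverts A" "w \<in> pverts A" "x \<in> pverts B" "y \<in> pverts B" "(v, x) \<noteq> (w, y)"
    "v = w \<or> (v, w) \<in> parcs A" "x = y \<or> (x, y) \<in> parcs B"
  shows "((v, x), (w, y)) \<in> parcs (A \<boxtimes> B)"
  using assms by (auto simp: strong_product_def)

lemma pair_graph_strong_product:
  assumes "pair_graph A" "pair_graph B"
  shows "pair_graph (A \<boxtimes> B)"
proof (rule pair_graphI)
  show "finite (pverts (A \<boxtimes> B))"
    using assms[THEN pair_graph_finite] by (simp add: strong_product_def)
  show "sym (parcs (A \<boxtimes> B))"
    using assms[THEN pair_graph_sym] unfolding strong_product_def sym_def by auto
qed (auto simp: strong_product_def)

lemma contained_inI:
  assumes G: "pair_graph G" and X: "pair_graph X" and inj: "inj_on \<phi> (pverts G)"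
    and verts: "\<phi> ` pverts G \<subseteq> pverts X"
    and arcs: "\<And>u w. (u, w) \<in> parcs G \<Longrightarrow> (\<phi> u, \<phi> w) \<in> parcs X"
  shows "contained_in G X"
proof -
  let ?S = "\<lparr>pverts = \<phi> ` pverts G, parcs = map_prod \<phi> \<phi> ` parcs G\<rparr>"
  have S: "pair_graph ?S"
  proof (rule pair_graphI)
    show "finite (pverts ?S)" using pair_graph_finite[OF G] by simp
    show "parcs ?S \<subseteq> pverts ?S \<times> pverts ?S" using pair_graph_arcsD[OF G] by auto
    show "sym (parcs ?S)"
    proof (rule symI)
      fix a b assume "(a, b) \<in> parcs ?S"
      then obtain u w where "(u, w) \<in> parcs G" "a = \<phi> u" "b = \<phi> w" by auto
      then have "(b, a) = map_prod \<phi> \<phi> (w, u)" "(w, u) \<in> parcs G"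
        using pair_graph_arcsD(4)[OF G, of u w] by auto
      then have "(b, a) \<in> map_prod \<phi> \<phi> ` parcs G" by (rule image_eqI)
      then show "(b, a) \<in> parcs ?S" by simp
    qed
    show "x \<noteq> y" if "(x, y) \<in> parcs ?S" for x y
      using that arcs pair_graph_arcsD(3)[OF X] by auto
  qed
  moreover have "subgraph (with_proj ?S) (with_proj X)"
    by (rule subgraph_with_projI[OF S X]) (use verts arcs in auto)
  moreover have "digraph_iso (with_proj G) (with_proj ?S)"
    by (rule digraph_iso_with_projI[OF G inj]) simp_all
  ultimately show ?thesis unfolding contained_in_def by blast
qed

section \<open>Embedding into the strong product\<close>

theorem theorem29:
  fixes s t :: nat and G :: "'a pair_pre_digraph"
  assumes "2 \<le> s" and "2 \<le> t"
    and "pair_graph G"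
    and "Kstar_minor_free s t G"
  shows "\<exists>(H :: nat pair_pre_digraph) (P :: nat pair_pre_digraph) (K :: nat pair_pre_digraph).
    pair_graph H \<and> simple_treewidth H \<le> s \<and>
    path_graph P \<and>
    complete_digraph ((t - 1) * layered_treewidth G) (with_proj K) \<and>
    contained_in G (H \<boxtimes> P \<boxtimes> K)"
proof -
  note G = assms(3)
  have finG: "finite (pverts G)" by (rule pair_graph_finite[OF G])
  define m where "m = (t - 1) * layered_treewidth G"
  obtain L and T :: "nat pair_pre_digraph" and W where L: "layering G L"
    and td: "tree_decomposition G T W"
    and LW: "\<And>i x. x \<in> pverts T \<Longrightarrow> card (L i \<inter> W x) \<le> layered_treewidth G"
    using layered_treewidth_witness[OF G] by blast
  interpret Kstar_free_decomposed G T W s t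
    by (rule Kstar_free_decomposed.intro[OF G td assms(4,2)])
  obtain \<sigma> where v: "valid \<sigma>" and r: "rest \<sigma> = {}" using partition_exists assms(1) by auto
  note vD = validD[OF v, unfolded r]
  define n where "n = size_of \<sigma>"
  define B where "B = earlier \<sigma>"
  define H where "H = \<lparr>pverts = {..<n}, parcs = {(i, j). i < n \<and> j < n \<and> (i \<in> B j \<or> j \<in> B i)}\<rparr>"
  have H: "pair_graph H \<and> simple_treewidth H \<le> s"
    unfolding H_def n_def B_def
  proof (rule simple_treewidth_le[where p = "parent \<sigma>"])
    show "parent \<sigma> i < i \<and> earlier \<sigma> i \<subseteq> insert (parent \<sigma> i) (earlier \<sigma> (parent \<sigma> i))"
      if "i < size_of \<sigma>" "0 < i" for i using vD(3,4) that by blast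
    show "0 < s" using assms(1) by simp
  qed (fact vD(1,2,6,7) earlier_less[OF v])+
  have Lv: "\<exists>i. u \<in> L i" if "u \<in> pverts G" for u using L that unfolding layering_def by blast
  define y where "y u = (SOME i. u \<in> L i)" for u
  have yL: "u \<in> L (y u)" if "u \<in> pverts G" for u
    unfolding y_def using someI_ex[OF Lv[OF that]] .
  have LG: "L i \<subseteq> pverts G" for i using L unfolding layering_def by blast
  \<comment> \<open>The \<open>0\<close> gives \<open>Max\<close> a value even if \<open>G\<close>
    has no vertices.\<close>
  define N where "N = Max (insert 0 (y ` pverts G))"
  have yN: "y u < Suc N" if "u \<in> pverts G" for u
    unfolding N_def using finG that by (simp add: less_Suc_eq_le)
  define vs where "vs = [0..<Suc N]"
  define P where "P = \<lparr>pverts = set vs, parcs = {(u, v). \<exists>i. Suc i < length vs \<and>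
    ((u = vs ! i \<and> v = vs ! Suc i) \<or> (u = vs ! Suc i \<and> v = vs ! i))}\<rparr>"
  have pathP: "path_graph P"
    unfolding path_graph_def by (rule exI[of _ vs]) (simp add: P_def vs_def)
  have vsi: "vs ! i = i" if "i < Suc N" for i using that by (simp add: vs_def del: upt_Suc)
  have lvs: "length vs = Suc N" by (simp add: vs_def)
  have parcsP: "(a, b) \<in> parcs P \<longleftrightarrow> a \<le> N \<and> b \<le> N \<and> (b = Suc a \<or> a = Suc b)" for a b
  proof -
    have "(a, b) \<in> parcs P \<longleftrightarrow> (\<exists>i < N. (a = i \<and> b = Suc i) \<or> (a = Suc i \<and> b = i))"
      unfolding P_def by (auto simp: lvs vsi)
    then show ?thesis using Suc_le_eq by auto
  qed
  have vertsP: "pverts P = {..N}" by (auto simp: P_def vs_def)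
  have P: "pair_graph P"
    by (rule pair_graphI) (auto simp: parcsP vertsP sym_def)
  define K :: "nat pair_pre_digraph" where
    "K = \<lparr>pverts = {..<m}, parcs = {(u, v). u < m \<and> v < m \<and> u \<noteq> v}\<rparr>"
  have compl: "complete_digraph m (with_proj K)"
    unfolding complete_digraph_pair_def K_def by auto
  have K: "pair_graph K" by (rule pair_graphI) (auto simp: K_def sym_def)
  define A where "A i l = {u \<in> pverts G. label \<sigma> u = i \<and> y u = l}" for i l
  \<comment> \<open>A part is covered by at most \<open>t - 1\<close> bags, each meeting a layer in
    at most \<open>layered_treewidth G\<close> vertices. So part and layer share at most
    \<open>m\<close> vertices, which can be numbered injectively.\<close>
  have "\<exists>g. g ` A i l \<subseteq> {..<m} \<and> inj_on g (A i l)" if i: "i < n" for i l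
  proof -
    obtain Y where Y: "Y \<subseteq> pverts T" "finite Y" "card Y \<le> t - 1"
      "{u \<in> pverts G. label \<sigma> u = i} \<subseteq> \<Union>(W ` Y)"
      using vD(9)[of i] i by (auto simp: n_def)
    have "A i l \<subseteq> (\<Union>x \<in> Y. L l \<inter> W x)"
    proof
      fix u assume "u \<in> A i l"
      then have "u \<in> L l" "u \<in> \<Union>(W ` Y)" using yL Y(4) by (auto simp: A_def)
      then show "u \<in> (\<Union>x \<in> Y. L l \<inter> W x)" by blast
    qed
    moreover have "finite (\<Union>x \<in> Y. L l \<inter> W x)"
      using Y(2) finite_subset[OF LG finG] by blast
    ultimately have "card (A i l) \<le> card (\<Union>x \<in> Y. L l \<inter> W x)" by (rule card_mono[rotated])
    also have "\<dots> \<le> (\<Sum>x \<in> Y. card (L l \<inter> W x))" by (rule card_UN_le[OF Y(2)])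
    also have "\<dots> \<le> (\<Sum>x \<in> Y. layered_treewidth G)" using LW Y(1) by (intro sum_mono) blast
    also have "\<dots> \<le> m" using Y(3) by (simp add: m_def)
    finally have "card (A i l) \<le> card {..<m}" by simp
    moreover have "finite (A i l)" using finG by (simp add: A_def)
    ultimately show ?thesis by (intro card_le_inj) simp_all
  qed
  then obtain g where g: "\<And>i l. i < n \<Longrightarrow> g i l ` A i l \<subseteq> {..<m} \<and> inj_on (g i l) (A i l)" by metis
  \<comment> \<open>The coordinates are the part, the layer, and the number among the vertices
    common to both.\<close>
  define \<phi> where "\<phi> u = ((label \<sigma> u, y u), g (label \<sigma> u) (y u) u)" for u
  have lab: "label \<sigma> u < n" if "u \<in> pverts G" for u using vD(8)[OF that] by (simp add: n_def)
  have gm: "g (label \<sigma> u) (y u) u < m" if "u \<in> pverts G" for u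
    using g[OF lab[OF that], of "y u"] that by (auto simp: A_def)
  have inj: "inj_on \<phi> (pverts G)"
  proof (rule inj_onI)
    fix u w assume uw: "u \<in> pverts G" "w \<in> pverts G" "\<phi> u = \<phi> w"
    then have "u \<in> A (label \<sigma> u) (y u)" "w \<in> A (label \<sigma> u) (y u)"
      "g (label \<sigma> u) (y u) u = g (label \<sigma> u) (y u) w" by (auto simp: \<phi>_def A_def)
    then show "u = w" using g[OF lab[OF uw(1)], of "y u"] by (meson inj_onD)
  qed
  have arc: "(\<phi> u, \<phi> w) \<in> parcs (H \<boxtimes> P \<boxtimes> K)" if uw: "(u, w) \<in> parcs G" for u w
  proof -
    have G2: "u \<in> pverts G" "w \<in> pverts G" "u \<noteq> w" using pair_graph_arcsD[OF G uw] by auto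
    have ne: "\<phi> u \<noteq> \<phi> w" using inj_onD[OF inj] G2 by blast
    have 1: "label \<sigma> u = label \<sigma> w \<or> (label \<sigma> u, label \<sigma> w) \<in> parcs H"
      using vD(10)[OF uw] lab G2 by (auto simp: H_def B_def)
    have "\<bar>int (y u) - int (y w)\<bar> \<le> 1"
      using L uw yL[OF G2(1)] yL[OF G2(2)] unfolding layering_def by blast
    then have "y u = y w \<or> y w = Suc (y u) \<or> y u = Suc (y w)" by linarith
    then have 2: "y u = y w \<or> (y u, y w) \<in> parcs P"
      using parcsP yN[OF G2(1)] yN[OF G2(2)] by auto
    \<comment> \<open>\<open>K\<close> is complete, so this coordinate never obstructs
      adjacency.\<close>
    have 3: "g (label \<sigma> u) (y u) u = g (label \<sigma> w) (y w) w \<or>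
      (g (label \<sigma> u) (y u) u, g (label \<sigma> w) (y w) w) \<in> parcs K"
      using gm[OF G2(1)] gm[OF G2(2)] by (auto simp: K_def)
    have HP: "(label \<sigma> a, y a) \<in> pverts (H \<boxtimes> P)" if "a \<in> pverts G" for a
      using lab[OF that] yN[OF that] by (simp add: strong_product_def H_def vertsP)
    have "(label \<sigma> u, y u) = (label \<sigma> w, y w) \<or> ((label \<sigma> u, y u), (label \<sigma> w, y w)) \<in> parcs (H \<boxtimes> P)"
      using strong_product_arcI[of "label \<sigma> u" H "label \<sigma> w" "y u" P "y w"] 1 2
        HP[OF G2(1)] HP[OF G2(2)] by (auto simp: strong_product_def)
    then show ?thesis unfolding \<phi>_def
      using ne 3 HP G2 gm[OF G2(1)] gm[OF G2(2)]
      by (intro strong_product_arcI) (auto simp: \<phi>_def K_def)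
  qed
  have "contained_in G (H \<boxtimes> P \<boxtimes> K)"
  proof (rule contained_inI[OF G _ inj _ arc])
    show "pair_graph (H \<boxtimes> P \<boxtimes> K)" using H P K by (intro pair_graph_strong_product) simp_all
    show "\<phi> ` pverts G \<subseteq> pverts (H \<boxtimes> P \<boxtimes> K)"
    proof
      fix z assume "z \<in> \<phi> ` pverts G"
      then obtain u where u: "u \<in> pverts G" "z = \<phi> u" by blast
      then show "z \<in> pverts (H \<boxtimes> P \<boxtimes> K)"
        using lab[OF u(1)] yN[OF u(1)] gm[OF u(1)]
        by (simp add: strong_product_def H_def vertsP K_def \<phi>_def)
    qed
  qed
  then show ?thesis using H pathP compl unfolding m_def by blast
qed

end
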